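(* Let $H$ and $H'$ be non-isomorphic graphs, each of which is either $3$-connected or isomorphic to $K_3$. Then $\mathcal{M}_q(H)\neq\mathcal{M}_q(H')$ for all integers $q\ge 2$.
   Context: All graphs are finite and simple. A graph $G$ is $q$-Ramsey for $H$ if every colouring of $E(G)$ with $q$ colours contains a monochromatic copy of $H$. $G$ is $q$-Ramsey-minimal for $H$ if it is $q$-Ramsey for $H$ but no proper subgraph of $G$ is. $\mathcal{M}_q(H)$ denotes the set of all graphs that are $q$-Ramsey-minimal for $H$ (considered up to isomorphism). *)

theory Defs
  imports Main "HOL-Library.Ramsey"
begin

type_synonym 'a graph = "'a set \<times> 'a set set"

abbreviation verts :: "'a graph \<Rightarrow> 'a set" where
  "verts G \<equiv> fst G"

abbreviation edges :: "'a graph \<Rightarrow> 'a set set" where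
  "edges G \<equiv> snd G"

definition simple_graph :: "'a graph \<Rightarrow> bool" where
  "simple_graph G \<longleftrightarrow> finite (verts G) \<and> edges G \<subseteq> nsets (verts G) 2"

definition complete_graph :: "nat \<Rightarrow> nat graph" where
  "complete_graph n = ({..<n}, nsets {..<n} 2)"

definition graph_iso :: "'a graph \<Rightarrow> 'b graph \<Rightarrow> bool" where
  "graph_iso G H \<longleftrightarrow> (\<exists>f. bij_betw f (verts G) (verts H) \<and> edges H = (\<lambda>e. f ` e) ` edges G)"

definition subgraph :: "'a graph \<Rightarrow> 'a graph \<Rightarrow> bool" where
  "subgraph K G \<longleftrightarrow> simple_graph K \<and> verts K \<subseteq> verts G \<and> edges K \<subseteq> edges G"

definition delete_verts :: "'a graph \<Rightarrow> 'a set \<Rightarrow> 'a graph" where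
  "delete_verts G X = (verts G - X, {e \<in> edges G. e \<inter> X = {}})"

definition connected_graph :: "'a graph \<Rightarrow> bool" where
  "connected_graph G \<longleftrightarrow> verts G \<noteq> {} \<and>
     (\<forall>u\<in>verts G. \<forall>v\<in>verts G. (u, v) \<in> {(x, y). {x, y} \<in> edges G}\<^sup>*)"

text \<open>
  The usual convention that a k-connected graph has more than k vertices; in particular the
  triangle is not 3-connected, whereas the complete graph on four vertices is.
\<close>
definition k_connected :: "nat \<Rightarrow> 'a graph \<Rightarrow> bool" where
  "k_connected k G \<longleftrightarrow> k < card (verts G) \<and>
     (\<forall>X. X \<subseteq> verts G \<and> card X < k \<longrightarrow> connected_graph (delete_verts G X))"

text \<open>Copies of a graph are not required to be induced subgraphs.\<close>
definition ramsey_graph :: "nat \<Rightarrow> 'a graph \<Rightarrow> 'b graph \<Rightarrow> bool" where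
  "ramsey_graph q G H \<longleftrightarrow>
     (\<forall>c :: 'a set \<Rightarrow> nat. c ` edges G \<subseteq> {..<q} \<longrightarrow>
        (\<exists>K i. subgraph K G \<and> graph_iso K H \<and> i < q \<and> (\<forall>e\<in>edges K. c e = i)))"

definition ramsey_minimal :: "nat \<Rightarrow> 'a graph \<Rightarrow> 'b graph \<Rightarrow> bool" where
  "ramsey_minimal q G H \<longleftrightarrow> simple_graph G \<and> ramsey_graph q G H \<and>
     (\<forall>G'. subgraph G' G \<and> G' \<noteq> G \<longrightarrow> \<not> ramsey_graph q G' H)"

text \<open>
  The set of isomorphism classes of minimal Ramsey graphs. Every finite graph has an isomorphic
  copy with vertices in the natural numbers, so these represent all isomorphism classes,
  independently of the vertex type of \<open>H\<close>.
\<close>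
definition minimal_ramsey_graphs :: "nat \<Rightarrow> 'b graph \<Rightarrow> nat graph set set" where
  "minimal_ramsey_graphs q H = {G. ramsey_minimal q G H} // {(G, G'). graph_iso G G'}"

end

theory Submission imports Defs
begin

text \<open>
  A graph \<open>G\<close> is not \<open>q\<close>-Ramsey for \<open>H\<close> iff it has a \<open>q\<close>-colouring without monochromatic copy of \<open>H\<close>.
  If \<open>H\<close> and \<open>H'\<close> had the same minimal Ramsey graphs, they would have the same Ramsey graphs; up to
  symmetry \<open>H'\<close> does not embed into \<open>H\<close>. Copies of \<open>H\<close> and \<open>H'\<close> cannot be separated by two vertices,
  so gluing two graphs along a star whose leaves are far apart on one side creates no new copies.

  In a minimal Ramsey graph minus an edge \<open>ry\<close>, every good colouring uses all colours at \<open>r\<close>. Gluing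
  many copies of it at the common centre \<open>r\<close> along a sparse hypergraph without proper 2-colouring
  yields a Ramsey graph. The first identification of two leaves that makes the graph Ramsey exhibits
  a graph, Ramsey for neither \<open>H\<close> nor \<open>H'\<close>, in which two edges with a common endpoint get different
  colours in every good colouring for \<open>H\<close>, hence also for \<open>H'\<close>. Such negative senders, attached to a
  copy of \<open>H\<close> with \<open>q - 1\<close> pendant edges at each vertex, force that copy to be monochromatic. The
  result is Ramsey for \<open>H\<close> but not for \<open>H'\<close>.
\<close>

section \<open>Embeddings and good colourings\<close>


text \<open>Why the glued graph is Ramsey: in a good colouring of it, split the leaves by whether
  their edge to the centre has colour 0. Some hyperedge lies in one class, so the copy attached to
  it either misses colour 0 at the centre or sees only colour 0 there. Both contradict that all
  \<open>q\<close> colours, at least two, occur at \<open>r\<close>. Sparseness serves distance.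
  When a hyperedge is filled in, its vertices are far apart in what has been built, so the two
  leaves about to be identified are far apart as well. The sender inherits this distance, and it is
  what later allows attaching the sender to any graph, however close the endpoints there may be.
  Pendant edges replace senders that force equal colours: an edge that must differ from
  \<open>q - 1\<close> pairwise distinct colours has only one colour left. Since \<open>H'\<close>
  has no copy in \<open>H\<close> with its pendant edges, colourings of that graph are unrestricted
  for \<open>H'\<close>, and one can be chosen that satisfies all the required inequalities.\<close>

definition emb :: "('a \<Rightarrow> 'b) \<Rightarrow> 'a graph \<Rightarrow> 'b graph \<Rightarrow> bool" where
  "emb \<phi> L G \<longleftrightarrow> inj_on \<phi> (verts L) \<and> \<phi> ` verts L \<subseteq> verts G \<and> (\<forall>e\<in>edges L. \<phi> ` e \<in> edges G)"

definition good :: "nat \<Rightarrow> 'a graph \<Rightarrow> 'b graph \<Rightarrow> ('b set \<Rightarrow> nat) \<Rightarrow> bool" where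
  "good q L G c \<longleftrightarrow> c ` edges G \<subseteq> {..<q} \<and>
     (\<forall>\<phi>. emb \<phi> L G \<longrightarrow> \<not> (\<exists>i<q. \<forall>e\<in>edges L. c (\<phi> ` e) = i))"

definition colourable :: "nat \<Rightarrow> 'a graph \<Rightarrow> 'b graph \<Rightarrow> bool" where
  "colourable q L G \<longleftrightarrow> (\<exists>c. good q L G c)"

lemma simple_edgeE:
  assumes "simple_graph G" "e \<in> edges G"
  obtains u v where "e = {u, v}" "u \<noteq> v" "u \<in> verts G" "v \<in> verts G"
  using assms unfolding simple_graph_def nsets_2_eq by blast

lemma simple_edgeD:
  assumes "simple_graph G" "{u, v} \<in> edges G"
  shows "u \<noteq> v" "u \<in> verts G" "v \<in> verts G"
  using simple_edgeE[OF assms] by (metis doubleton_eq_iff insert_absorb2)+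

lemma simple_edge_subset: "simple_graph G \<Longrightarrow> e \<in> edges G \<Longrightarrow> e \<subseteq> verts G"
  by (metis empty_subsetI insert_subset simple_edgeE)

lemma simple_graphI:
  assumes "finite (verts G)"
    and "\<And>e. e \<in> edges G \<Longrightarrow> \<exists>u v. e = {u, v} \<and> u \<noteq> v \<and> u \<in> verts G \<and> v \<in> verts G"
  shows "simple_graph G"
  using assms unfolding simple_graph_def nsets_2_eq by fast

lemma simple_finite_edges: "simple_graph G \<Longrightarrow> finite (edges G)"
  unfolding simple_graph_def by (meson finite_imp_finite_nsets finite_subset)

lemma emb_comp:
  assumes "emb \<phi> L G" "emb \<psi> G F" shows "emb (\<psi> \<circ> \<phi>) L F"
proof -
  have "inj_on (\<psi> \<circ> \<phi>) (verts L)"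
    using assms unfolding emb_def by (meson comp_inj_on inj_on_subset)
  moreover have "(\<psi> \<circ> \<phi>) ` verts L \<subseteq> verts F"
    using assms unfolding emb_def by fastforce
  moreover have "\<forall>e\<in>edges L. (\<psi> \<circ> \<phi>) ` e \<in> edges F"
    using assms unfolding emb_def image_comp[symmetric] by blast
  ultimately show ?thesis unfolding emb_def by blast
qed

lemma emb_mono: "emb \<phi> L G \<Longrightarrow> verts G \<subseteq> verts F \<Longrightarrow> edges G \<subseteq> edges F \<Longrightarrow> emb \<phi> L F"
  unfolding emb_def by blast

lemma emb_id: "verts G \<subseteq> verts F \<Longrightarrow> edges G \<subseteq> edges F \<Longrightarrow> emb id G F"
  unfolding emb_def by auto

lemma good_pullback:
  assumes "emb \<psi> G F" "good q L F c" shows "good q L G (\<lambda>e. c (\<psi> ` e))"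
proof -
  have "(\<lambda>e. c (\<psi> ` e)) ` edges G \<subseteq> {..<q}"
    using assms unfolding emb_def good_def by blast
  moreover have "\<not> (\<exists>i<q. \<forall>e\<in>edges L. c (\<psi> ` \<phi> ` e) = i)" if "emb \<phi> L G" for \<phi>
    using assms(2) emb_comp[OF that assms(1)] unfolding good_def by (auto simp: image_comp)
  ultimately show ?thesis unfolding good_def by blast
qed

lemma good_subgraph:
  "verts G \<subseteq> verts F \<Longrightarrow> edges G \<subseteq> edges F \<Longrightarrow> good q L F c \<Longrightarrow> good q L G c"
  using good_pullback[OF emb_id, of G F q L c] by simp

lemma colourable_emb: "emb \<psi> G F \<Longrightarrow> colourable q L F \<Longrightarrow> colourable q L G"
  unfolding colourable_def using good_pullback by blast

lemma good_recolour:
  assumes c: "good q L G c" and \<pi>: "bij_betw \<pi> {..<q} {..<q}"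
  shows "good q L G (\<pi> \<circ> c)"
proof -
  have "(\<pi> \<circ> c) ` edges G \<subseteq> {..<q}"
    using c bij_betw_imp_surj_on[OF \<pi>] unfolding good_def by fastforce
  moreover have "\<not> (\<exists>i<q. \<forall>e\<in>edges L. (\<pi> \<circ> c) (\<phi> ` e) = i)" if \<phi>: "emb \<phi> L G" for \<phi>
  proof
    assume "\<exists>i<q. \<forall>e\<in>edges L. (\<pi> \<circ> c) (\<phi> ` e) = i"
    then obtain i where i: "i < q" "\<forall>e\<in>edges L. \<pi> (c (\<phi> ` e)) = i" by auto
    then have "i \<in> \<pi> ` {..<q}" using bij_betw_imp_surj_on[OF \<pi>] by simp
    then obtain j where j: "j < q" "\<pi> j = i" by auto
    have "c (\<phi> ` e) = j" if e: "e \<in> edges L" for e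
    proof -
      have "\<phi> ` e \<in> edges G" using \<phi> e unfolding emb_def by blast
      then have "c (\<phi> ` e) < q" using c unfolding good_def by blast
      then show ?thesis
        using i(2) e j inj_onD[OF bij_betw_imp_inj_on[OF \<pi>], of "c (\<phi> ` e)" j] by simp
    qed
    then show False using c \<phi> j(1) unfolding good_def by blast
  qed
  ultimately show ?thesis unfolding good_def by blast
qed

lemma simple_image:
  assumes "simple_graph L" "inj_on \<phi> (verts L)"
  shows "simple_graph (\<phi> ` verts L, (`) \<phi> ` edges L)"
proof (rule simple_graphI)
  show "finite (verts (\<phi> ` verts L, (`) \<phi> ` edges L))"
    using assms(1) unfolding simple_graph_def by simp
next
  fix e assume "e \<in> edges (\<phi> ` verts L, (`) \<phi> ` edges L)"
  then obtain f where f: "f \<in> edges L" "e = \<phi> ` f" by auto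
  obtain u v where "f = {u, v}" "u \<noteq> v" "u \<in> verts L" "v \<in> verts L"
    using simple_edgeE[OF assms(1) f(1)] .
  then have "e = {\<phi> u, \<phi> v} \<and> \<phi> u \<noteq> \<phi> v \<and> \<phi> u \<in> \<phi> ` verts L \<and> \<phi> v \<in> \<phi> ` verts L"
    using f(2) assms(2) by (auto simp: inj_on_def)
  then show "\<exists>u v. e = {u, v} \<and> u \<noteq> v \<and> u \<in> verts (\<phi> ` verts L, (`) \<phi> ` edges L) \<and>
      v \<in> verts (\<phi> ` verts L, (`) \<phi> ` edges L)"
    by (metis fst_conv)
qed

lemma graph_iso_image:
  assumes "inj_on \<phi> (verts L)"
  shows "graph_iso L (\<phi> ` verts L, (`) \<phi> ` edges L)"
  unfolding graph_iso_def using assms by (auto intro!: exI[of _ \<phi>] simp: bij_betw_def)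

lemma graph_iso_refl: "graph_iso G G"
  unfolding graph_iso_def by (rule exI[of _ id]) auto

lemma graph_iso_sym:
  assumes "simple_graph G" "graph_iso G F"
  shows "graph_iso F G"
proof -
  obtain f where f: "bij_betw f (verts G) (verts F)" "edges F = (`) f ` edges G"
    using assms(2) unfolding graph_iso_def by blast
  let ?g = "inv_into (verts G) f"
  have "?g ` f ` e = e" if "e \<in> edges G" for e
    using simple_edge_subset[OF assms(1) that] f(1) unfolding bij_betw_def
    by (meson inv_into_image_cancel)
  then have "(`) ?g ` edges F = edges G"
    unfolding f(2) image_image by simp
  then show ?thesis
    unfolding graph_iso_def using bij_betw_inv_into[OF f(1)] by (intro exI[of _ ?g]) simp
qed

section \<open>Ramsey graphs, minimal Ramsey graphs and colourability\<close>

lemma graph_iso_emb: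
  assumes "graph_iso G F" obtains f where "emb f G F"
  using assms unfolding graph_iso_def emb_def bij_betw_def by fastforce

lemma ramsey_iff:
  assumes L: "simple_graph L"
  shows "ramsey_graph q (G :: 'b graph) L \<longleftrightarrow> \<not> colourable q L G"
proof -
  have "(\<exists>K i. subgraph K G \<and> graph_iso K L \<and> i < q \<and> (\<forall>e\<in>edges K. c e = i)) \<longleftrightarrow>
      (\<exists>\<phi>. emb \<phi> L G \<and> (\<exists>i<q. \<forall>e\<in>edges L. c (\<phi> ` e) = i))" for c :: "'b set \<Rightarrow> nat"
  proof
    assume "\<exists>K i. subgraph K G \<and> graph_iso K L \<and> i < q \<and> (\<forall>e\<in>edges K. c e = i)"
    then obtain K i where K: "subgraph K G" "graph_iso K L" "i < q" "\<forall>e\<in>edges K. c e = i" by blast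
    have "graph_iso L K" using graph_iso_sym K(1,2) unfolding subgraph_def by blast
    then obtain \<phi> where \<phi>: "emb \<phi> L K" by (rule graph_iso_emb)
    have "emb \<phi> L G" using emb_mono[OF \<phi>] K(1) unfolding subgraph_def by blast
    moreover have "\<forall>e\<in>edges L. c (\<phi> ` e) = i" using \<phi> K(4) unfolding emb_def by blast
    ultimately show "\<exists>\<phi>. emb \<phi> L G \<and> (\<exists>i<q. \<forall>e\<in>edges L. c (\<phi> ` e) = i)"
      using K(3) by blast
  next
    assume "\<exists>\<phi>. emb \<phi> L G \<and> (\<exists>i<q. \<forall>e\<in>edges L. c (\<phi> ` e) = i)"
    then obtain \<phi> i where \<phi>: "emb \<phi> L G" "i < q" "\<forall>e\<in>edges L. c (\<phi> ` e) = i" by blast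
    let ?K = "(\<phi> ` verts L, (`) \<phi> ` edges L)"
    have inj: "inj_on \<phi> (verts L)" using \<phi>(1) unfolding emb_def by blast
    have "subgraph ?K G"
      using simple_image[OF L inj] \<phi>(1) unfolding subgraph_def emb_def by auto
    moreover have "graph_iso ?K L" using graph_iso_sym[OF L graph_iso_image[OF inj]] .
    moreover have "\<forall>e\<in>edges ?K. c e = i" using \<phi>(3) by simp
    ultimately show "\<exists>K i. subgraph K G \<and> graph_iso K L \<and> i < q \<and> (\<forall>e\<in>edges K. c e = i)"
      using \<phi>(2) by blast
  qed
  then show ?thesis unfolding ramsey_graph_def colourable_def good_def by auto
qed

text \<open>Descend to proper Ramsey subgraphs. The measure counts vertices as well as edges, since
  a proper subgraph may differ by isolated vertices only.\<close>

lemma ex_ramsey_minimal_subgraph: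
  assumes "simple_graph G" "ramsey_graph q G L"
  shows "\<exists>M. subgraph M G \<and> ramsey_minimal q M L"
  using assms
proof (induction "card (verts G) + card (edges G)" arbitrary: G rule: less_induct)
  case less
  show ?case
  proof (cases "ramsey_minimal q G L")
    case True
    then show ?thesis using less.prems(1) unfolding subgraph_def by blast
  next
    case False
    then obtain G' where G': "subgraph G' G" "G' \<noteq> G" "ramsey_graph q G' L"
      using less.prems unfolding ramsey_minimal_def by blast
    have fin: "finite (verts G)" "finite (edges G)"
      using less.prems(1) simple_finite_edges[OF less.prems(1)] unfolding simple_graph_def by auto
    have sub: "verts G' \<subseteq> verts G" "edges G' \<subseteq> edges G"
      using G'(1) unfolding subgraph_def by auto
    have le: "card (verts G') \<le> card (verts G)" "card (edges G') \<le> card (edges G)"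
      using sub fin by (simp_all add: card_mono)
    have "verts G' \<noteq> verts G \<or> edges G' \<noteq> edges G" using G'(2) by (simp add: prod_eq_iff)
    then have "card (verts G') \<noteq> card (verts G) \<or> card (edges G') \<noteq> card (edges G)"
      using card_subset_eq[OF fin(1) sub(1)] card_subset_eq[OF fin(2) sub(2)] by argo
    then have "card (verts G') + card (edges G') < card (verts G) + card (edges G)"
      using le by linarith
    moreover have "simple_graph G'" using G'(1) unfolding subgraph_def by blast
    ultimately obtain M where M: "subgraph M G'" "ramsey_minimal q M L"
      using less.hyps G'(3) by blast
    then have "subgraph M G" using sub unfolding subgraph_def by (meson subset_trans)
    then show ?thesis using M(2) by blast
  qed
qed

text \<open>If \<open>G\<close> were Ramsey for \<open>L\<close>, it would contain a minimal
  \<open>M\<close>, and the class of \<open>M\<close> is also the class of some \<open>M'\<close>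
  that is minimal for \<open>L'\<close>. Then \<open>M'\<close> embeds into \<open>G\<close>, making
  \<open>G\<close> Ramsey for \<open>L'\<close>.\<close>

lemma colourable_transfer:
  fixes L :: "'a graph" and L' :: "'b graph" and G :: "nat graph"
  assumes "simple_graph L" "simple_graph L'"
    and "minimal_ramsey_graphs q L = minimal_ramsey_graphs q L'"
    and "simple_graph G" "colourable q L' G"
  shows "colourable q L G"
proof (rule ccontr)
  assume "\<not> colourable q L G"
  then obtain M where M: "subgraph M G" "ramsey_minimal q M L"
    using ex_ramsey_minimal_subgraph assms(1,4) ramsey_iff by blast
  let ?r = "{(G :: nat graph, G' :: nat graph). graph_iso G G'}"
  have "?r `` {M} \<in> minimal_ramsey_graphs q L"
    unfolding minimal_ramsey_graphs_def by (rule quotientI) (simp add: M(2))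
  then have "?r `` {M} \<in> {G. ramsey_minimal q G L'} // ?r"
    unfolding assms(3) unfolding minimal_ramsey_graphs_def .
  then obtain M' where M': "M' \<in> {G. ramsey_minimal q G L'}" "?r `` {M} = ?r `` {M'}"
    by (rule quotientE)
  \<comment> \<open>Reflexivity puts \<open>M\<close> into its own class, which is the class of
    \<open>M'\<close>.\<close>
  then have "graph_iso M' M" using graph_iso_refl[of M] by blast
  then obtain f where "emb f M' M" using graph_iso_emb by blast
  moreover have "emb id M G" using M(1) emb_id unfolding subgraph_def by blast
  ultimately have "colourable q L' M'" using assms(5) colourable_emb emb_comp by blast
  then show False using M'(1) ramsey_iff[OF assms(2), of q M'] unfolding ramsey_minimal_def by simp
qed

text \<open>Injections in both directions equate the finite numbers of vertices and of edges, so
  \<open>\<phi>\<close> is onto on both.\<close>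

lemma emb_antisym:
  assumes "simple_graph L" "simple_graph L'" "emb \<phi> L L'" "emb \<psi> L' L"
  shows "graph_iso L L'"
proof -
  have fin: "finite (verts L)" "finite (verts L')" "finite (edges L)" "finite (edges L')"
    using assms(1,2) simple_finite_edges[OF assms(1)] simple_finite_edges[OF assms(2)]
    unfolding simple_graph_def by auto
  have "card (verts L') \<le> card (verts L)"
    using assms(4) fin unfolding emb_def by (metis card_inj_on_le)
  then have V: "\<phi> ` verts L = verts L'"
    using assms(3) fin unfolding emb_def by (metis card_image card_seteq)
  have inj: "inj_on ((`) \<phi>) (edges L)" "inj_on ((`) \<psi>) (edges L')"
    using assms simple_edge_subset unfolding emb_def by (meson inj_onI inj_on_image_eq_iff)+
  have "(`) \<psi> ` edges L' \<subseteq> edges L" using assms(4) unfolding emb_def by blast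
  then have "card (edges L') \<le> card (edges L)"
    using card_inj_on_le[OF inj(2)] fin(3) by blast
  moreover have "(`) \<phi> ` edges L \<subseteq> edges L'" using assms(3) unfolding emb_def by blast
  ultimately have "(`) \<phi> ` edges L = edges L'"
    using fin(4) by (simp add: card_image[OF inj(1)] card_seteq)
  then show ?thesis
    unfolding graph_iso_def using V assms(3) unfolding emb_def bij_betw_def by auto
qed

text \<open>Moves \<open>L\<close> to the naturals, where the host graphs live and fresh vertices
  are always available.\<close>

lemma ex_nat_copy:
  assumes "simple_graph L"
  obtains L' :: "nat graph" and f g where "simple_graph L'" "emb f L L'" "emb g L' L"
proof -
  have "finite (verts L)" using assms unfolding simple_graph_def by blast
  then obtain f :: "'a \<Rightarrow> nat" where f: "inj_on f (verts L)"
    by (metis finite_imp_inj_to_nat_seg)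
  let ?L = "(f ` verts L, (`) f ` edges L)"
  have iso: "graph_iso L ?L" using graph_iso_image[OF f] .
  obtain g where "emb g L ?L" using graph_iso_emb[OF iso] .
  moreover obtain h where "emb h ?L L" using graph_iso_emb[OF graph_iso_sym[OF assms iso]] .
  ultimately show thesis using that[OF simple_image[OF assms f]] by blast
qed

section \<open>Gluing along a star\<close>


text \<open>The bound 3 rather than 4 on the number of vertices makes this include \<open>K\<^sub>3\<close>.\<close>
definition triconn :: "'a graph \<Rightarrow> bool" where
  "triconn L \<longleftrightarrow> simple_graph L \<and> 3 \<le> card (verts L) \<and>
     (\<forall>X\<subseteq>verts L. card X < 3 \<longrightarrow> connected_graph (delete_verts L X))"

text \<open>Walks must avoid the centre \<open>w\<close>: through it any two leaves are at distance
  2.\<close>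

definition adj_avoiding :: "'a graph \<Rightarrow> 'a \<Rightarrow> ('a \<times> 'a) set" where
  "adj_avoiding F w = {(a, b). {a, b} \<in> edges F \<and> a \<noteq> w \<and> b \<noteq> w}"

text \<open>Distance greater than \<open>D\<close> in \<open>F - w\<close>. The case
  \<open>m = 0\<close> makes far vertices distinct.\<close>

definition far :: "nat \<Rightarrow> 'a graph \<Rightarrow> 'a \<Rightarrow> 'a \<Rightarrow> 'a \<Rightarrow> bool" where
  "far D F w x y \<longleftrightarrow> (\<forall>m\<le>D. (x, y) \<notin> adj_avoiding F w ^^ m)"

definition graph_union :: "'a graph \<Rightarrow> 'a graph \<Rightarrow> 'a graph" where
  "graph_union F G = (verts F \<union> verts G, edges F \<union> edges G)"

text \<open>The two graphs meet in the star with centre \<open>w\<close> and leaves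
  \<open>Y\<close>. The condition is asymmetric: only \<open>F\<close> keeps the leaves apart, while
  in \<open>G\<close> they may even be adjacent.\<close>

definition amalgam :: "nat \<Rightarrow> 'a graph \<Rightarrow> 'a graph \<Rightarrow> 'a \<Rightarrow> 'a set \<Rightarrow> bool" where
  "amalgam D F G w Y \<longleftrightarrow> simple_graph F \<and> simple_graph G \<and> w \<notin> Y \<and>
     verts F \<inter> verts G = insert w Y \<and> (\<forall>y\<in>Y. {w, y} \<in> edges F \<and> {w, y} \<in> edges G) \<and>
     (\<forall>x\<in>Y. \<forall>y\<in>Y. x \<noteq> y \<longrightarrow> far D F w x y)"

lemma triconn_simple: "triconn L \<Longrightarrow> simple_graph L"
  unfolding triconn_def by blast

lemma triconn_bound_pos:
  assumes "triconn L" "(card (verts L))\<^sup>2 \<le> D" shows "0 < D"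
proof -
  have "0 < (card (verts L))\<^sup>2" using assms(1) unfolding triconn_def by simp
  then show ?thesis using assms(2) by linarith
qed

text \<open>Deleting \<open>y\<close> leaves a connected graph with another vertex besides
  \<open>x\<close>, so \<open>x\<close> keeps a neighbour. Applied twice, this yields two neighbours
  of \<open>x\<close>.\<close>

lemma triconn_neighbour:
  assumes L: "triconn L" and x: "x \<in> verts L"
  obtains z where "{x, z} \<in> edges L" "z \<noteq> y" "z \<noteq> x"
proof -
  have simple: "simple_graph L" and card: "3 \<le> card (verts L)"
    using L unfolding triconn_def by auto
  have fin: "finite (verts L)" using simple unfolding simple_graph_def by blast
  \<comment> \<open>This form also covers \<open>y = x\<close> and \<open>y\<close> outside
    \<open>L\<close>, where nothing is deleted.\<close>
  define X where "X = ({y} - {x}) \<inter> verts L"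
  have "card X \<le> card {y}" unfolding X_def by (intro card_mono) auto
  then have X1: "card X \<le> 1" by simp
  moreover have "X \<subseteq> verts L" unfolding X_def by blast
  ultimately have conn: "connected_graph (delete_verts L X)"
    using L unfolding triconn_def by simp
  have "card (insert x X) \<le> 2" using X1 card_insert_le_m1[of 2 X x] by simp
  then have "\<not> verts L \<subseteq> insert x X"
    using card card_mono[of "insert x X" "verts L"] finite_subset[OF \<open>X \<subseteq> verts L\<close> fin] by fastforce
  then obtain t where t: "t \<in> verts L" "t \<noteq> x" "t \<notin> X" by blast
  have "x \<notin> X" unfolding X_def by blast
  then have "(x, t) \<in> {(a, b). {a, b} \<in> edges (delete_verts L X)}\<^sup>*"
    using conn x t unfolding connected_graph_def delete_verts_def by simp
  then obtain z where "{x, z} \<in> edges (delete_verts L X)"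
    using t(2) by (auto elim: converse_rtranclE)
  then have z: "{x, z} \<in> edges L" "z \<notin> X" unfolding delete_verts_def by auto
  have "z \<noteq> x" "z \<in> verts L" using simple_edgeD[OF simple z(1)] by auto
  then show thesis using that[OF z(1)] z(2) unfolding X_def by blast
qed

text \<open>Every vertex of \<open>L\<close> has two neighbours, whose distinct images would both
  have to be \<open>v\<close>.\<close>

lemma pendant_not_in_emb:
  assumes L: "triconn L" and \<phi>: "emb \<phi> L F" and p: "\<And>e. e \<in> edges F \<Longrightarrow> p \<in> e \<Longrightarrow> e = {p, v}"
  shows "p \<notin> \<phi> ` verts L"
proof
  assume "p \<in> \<phi> ` verts L"
  then obtain x where x: "x \<in> verts L" "p = \<phi> x" by blast
  obtain z where z: "{x, z} \<in> edges L" "z \<noteq> x" by (rule triconn_neighbour[OF L x(1), of x])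
  obtain z' where z': "{x, z'} \<in> edges L" "z' \<noteq> z" "z' \<noteq> x"
    by (rule triconn_neighbour[OF L x(1), of z])
  have inj: "inj_on \<phi> (verts L)" using \<phi> unfolding emb_def by blast
  have V: "z \<in> verts L" "z' \<in> verts L"
    using simple_edgeD[OF triconn_simple[OF L]] z(1) z'(1) by auto
  have "{p, \<phi> a} = {p, v}" if "{x, a} \<in> edges L" for a
  proof (rule p)
    have "\<phi> ` {x, a} \<in> edges F" using \<phi> that unfolding emb_def by blast
    then show "{p, \<phi> a} \<in> edges F" using x(2) by simp
  qed simp
  then have "{p, \<phi> z} = {p, v}" "{p, \<phi> z'} = {p, v}" using z z' by auto
  moreover have "\<phi> z \<noteq> p" "\<phi> z' \<noteq> p"
    using inj_onD[OF inj] V x z(2) z'(3) by metis+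
  ultimately have "\<phi> z = \<phi> z'" by (metis doubleton_eq_iff)
  then show False using inj_onD[OF inj] V z'(2) by metis
qed

section \<open>Copies and colourings in an amalgam\<close>

lemma relpow_homomorphism:
  assumes "\<And>a b. (a, b) \<in> R \<Longrightarrow> (f a, f b) \<in> S" "(a, b) \<in> R ^^ m"
  shows "(f a, f b) \<in> S ^^ m"
  using assms(2)
proof (induction m arbitrary: b)
  case (Suc m)
  then obtain c where "(a, c) \<in> R ^^ m" "(c, b) \<in> R" by auto
  then show ?case using Suc.IH assms(1) by auto
qed simp

lemma amalgam_no_edge:
  assumes "amalgam D F G w Y" "0 < D" "x \<in> Y" "y \<in> Y"
  shows "{x, y} \<notin> edges F"
proof
  assume e: "{x, y} \<in> edges F"
  then have "x \<noteq> y" using simple_edgeD assms(1) unfolding amalgam_def by metis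
  then have "far D F w x y" "x \<noteq> w" "y \<noteq> w" using assms unfolding amalgam_def by auto
  moreover have "(x, y) \<in> adj_avoiding F w ^^ 1"
    using e \<open>x \<noteq> w\<close> \<open>y \<noteq> w\<close> unfolding adj_avoiding_def by simp
  ultimately show False using assms(2) unfolding far_def by (metis One_nat_def Suc_leI)
qed

text \<open>An edge between two leaves would be a walk of length 1, too short for far leaves. So
  inside the overlap \<open>F\<close> has only edges of the star, which \<open>G\<close>
  shares.\<close>

lemma amalgam_edge_in_F:
  assumes am: "amalgam D F G w Y" and D: "0 < D"
    and e: "e \<in> edges F" "e \<subseteq> insert w Y"
  obtains y where "y \<in> Y" "e = {w, y}"
proof -
  have "simple_graph F" using am unfolding amalgam_def by blast
  then obtain a b where ab: "e = {a, b}" "a \<noteq> b" using simple_edgeE[OF _ e(1)] by metis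
  then show thesis
    using that e amalgam_no_edge[OF am D, of a b] by (metis insert_commute insert_iff insert_subset)
qed

text \<open>
  If the copy leaves \<open>G\<close>, then a component of its part outside \<open>G\<close> reaches at most one vertex of \<open>Y\<close>,
  because \<open>Y\<close> is far apart in \<open>F\<close>. This vertex and \<open>w\<close> cannot separate the copy.
\<close>
lemma amalgam_emb:
  assumes am: "amalgam D F G w Y" and L: "triconn L" and D: "(card (verts L))\<^sup>2 \<le> D"
    and \<phi>: "emb \<phi> L (graph_union F G)"
  shows "emb \<phi> L F \<or> emb \<phi> L G"
proof -
  have simF: "simple_graph F" and simG: "simple_graph G" and wY: "w \<notin> Y"
    and VFG: "verts F \<inter> verts G = insert w Y"
    and wy: "\<And>y. y \<in> Y \<Longrightarrow> {w, y} \<in> edges F" "\<And>y. y \<in> Y \<Longrightarrow> {w, y} \<in> edges G"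
    and far: "\<And>x y. x \<in> Y \<Longrightarrow> y \<in> Y \<Longrightarrow> x \<noteq> y \<Longrightarrow> far D F w x y"
    using am unfolding amalgam_def by auto
  have inj: "inj_on \<phi> (verts L)" and \<phi>V: "\<And>v. v \<in> verts L \<Longrightarrow> \<phi> v \<in> verts F \<union> verts G"
    and \<phi>E: "\<And>e. e \<in> edges L \<Longrightarrow> \<phi> ` e \<in> edges F \<union> edges G"
    using \<phi> unfolding emb_def graph_union_def by auto
  have sim: "simple_graph L" and card: "3 \<le> card (verts L)" using L unfolding triconn_def by auto
  have fin: "finite (verts L)" using sim unfolding simple_graph_def by blast
  have D0: "0 < D" by (rule triconn_bound_pos[OF L D])
  show ?thesis
  proof (cases "\<phi> ` verts L \<subseteq> verts G")
    case True
    have "\<phi> ` e \<in> edges G" if e: "e \<in> edges L" for e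
    proof (rule ccontr)
      assume "\<phi> ` e \<notin> edges G"
      then have F: "\<phi> ` e \<in> edges F" using \<phi>E[OF e] by blast
      have "\<phi> ` e \<subseteq> verts G" using simple_edge_subset[OF sim e] True by blast
      then have "\<phi> ` e \<subseteq> insert w Y" using simple_edge_subset[OF simF F] VFG by blast
      then obtain y where "y \<in> Y" "\<phi> ` e = {w, y}" using amalgam_edge_in_F[OF am D0 F] by blast
      then show False using wy(2) \<open>\<phi> ` e \<notin> edges G\<close> by simp
    qed
    then show ?thesis using True inj unfolding emb_def by blast
  next
    case False
    then obtain u where u: "u \<in> verts L" "\<phi> u \<notin> verts G" by blast
    \<comment> \<open>\<open>Q\<close> holds the edges of the copy that run in \<open>F\<close> away
      from \<open>w\<close>, and \<open>C\<close> is the component of \<open>u\<close> in the part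
      outside \<open>G\<close>. Only \<open>X\<close>, the vertices next to \<open>C\<close> that
      land on leaves together with the preimage of \<open>w\<close>, can cut \<open>C\<close> off
      from the rest of the copy.\<close>
    define Q where "Q = {(a, b). {a, b} \<in> edges L \<and> {\<phi> a, \<phi> b} \<in> edges F \<and> \<phi> a \<noteq> w \<and> \<phi> b \<noteq> w}"
    define Q' where "Q' = Q \<inter> {(a, b). \<phi> a \<notin> verts G \<and> \<phi> b \<notin> verts G}"
    define C where "C = {v. (u, v) \<in> Q'\<^sup>*}"
    define N where "N = {b \<in> verts L. \<phi> b \<in> Y \<and> (\<exists>a\<in>C. {a, b} \<in> edges L)}"
    define X where "X = N \<union> {a \<in> verts L. \<phi> a = w}"
    have Q'Q: "Q' \<subseteq> Q" unfolding Q'_def by blast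
    have QV: "Q \<subseteq> verts L \<times> verts L"
      using simple_edgeD[OF sim] unfolding Q_def by auto
    have symQ: "(b, a) \<in> Q" if "(a, b) \<in> Q" for a b
      using that unfolding Q_def by (simp add: insert_commute)
    have symQ': "(b, a) \<in> Q'" if "(a, b) \<in> Q'" for a b
      using that symQ unfolding Q'_def by auto
    have CD: "v \<in> verts L \<and> \<phi> v \<notin> verts G" if "v \<in> C" for v
    proof -
      have "(u, v) \<in> Q'\<^sup>*" using that unfolding C_def by blast
      then show ?thesis
      proof cases
        case base then show ?thesis using u by blast
      next
        case (step y)
        then have "(y, v) \<in> Q'" by blast
        then show ?thesis using Q'Q QV unfolding Q'_def by blast
      qed
    qed
    have CC: "(a, b) \<in> Q\<^sup>*" if "a \<in> C" "b \<in> C" for a b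
    proof -
      have "sym Q'" using symQ' by (simp add: sym_def)
      then have "(a, u) \<in> Q'\<^sup>*" using that(1) unfolding C_def by (metis mem_Collect_eq symD sym_rtrancl)
      then have "(a, b) \<in> Q'\<^sup>*" using that(2) unfolding C_def by auto
      then show ?thesis using rtrancl_mono[OF Q'Q] by blast
    qed
    have CF: "\<phi> ` {a, b} \<in> edges F" "\<phi> b \<in> verts F" if "a \<in> C" "{a, b} \<in> edges L" for a b
    proof -
      have "\<phi> ` {a, b} \<notin> edges G"
        using CD[OF that(1)] simple_edge_subset[OF simG] by blast
      then show "\<phi> ` {a, b} \<in> edges F" using \<phi>E[OF that(2)] by blast
      then show "\<phi> b \<in> verts F" using simple_edge_subset[OF simF] by blast
    qed
    have Nuniq: "b = b'" if bN: "b \<in> N" "b' \<in> N" for b b'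
    proof -
      have aux: "\<exists>a\<in>C. (a, x) \<in> Q" if x: "x \<in> N" for x
      proof -
        obtain a where a: "a \<in> C" "{a, x} \<in> edges L" using x unfolding N_def by blast
        have "\<phi> a \<noteq> w" using CD[OF a(1)] VFG by blast
        moreover have "\<phi> x \<noteq> w" using x wY unfolding N_def by blast
        ultimately show ?thesis using a CF(1)[OF a] unfolding Q_def by auto
      qed
      obtain a a' where a: "a \<in> C" "(a, b) \<in> Q" "a' \<in> C" "(a', b') \<in> Q"
        using aux bN by blast
      have "(b, a) \<in> Q\<^sup>*" using symQ[OF a(2)] by blast
      then have "(b, b') \<in> Q\<^sup>*" using CC[OF a(1,3)] a(4) by (meson rtrancl.rtrancl_into_rtrancl rtrancl_trans)
      moreover have finQ: "finite Q" using QV fin by (meson finite_SigmaI finite_subset)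
      ultimately obtain m where m: "m \<le> card Q" "(b, b') \<in> Q ^^ m"
        unfolding rtrancl_finite_eq_relpow[OF finQ] by blast
      \<comment> \<open>Origin of the bound on \<open>D\<close>: a walk can be shortened to at most
        \<open>card Q\<close> steps, and \<open>Q\<close> is a set of ordered pairs of vertices of
        \<open>L\<close>.\<close>
      have "card Q \<le> (card (verts L))\<^sup>2"
        using card_mono[OF _ QV] fin by (simp add: card_cartesian_product power2_eq_square)
      then have "m \<le> D" using m(1) D by linarith
      moreover have "(\<phi> b, \<phi> b') \<in> adj_avoiding F w ^^ m"
        using relpow_homomorphism[OF _ m(2), of \<phi> "adj_avoiding F w"]
        unfolding Q_def adj_avoiding_def by blast
      ultimately have "\<phi> b = \<phi> b'" using far bN unfolding N_def far_def by blast
      then show ?thesis using inj_onD[OF inj] bN unfolding N_def by blast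
    qed
    have "finite N" unfolding N_def using fin by simp
    then have "card N \<le> 1" using Nuniq by (simp add: card_le_Suc0_iff_eq)
    moreover have "card {a \<in> verts L. \<phi> a = w} \<le> 1"
      using fin inj by (simp add: card_le_Suc0_iff_eq) (auto dest: inj_onD)
    ultimately have "card X < 3" using card_Un_le[of N "{a \<in> verts L. \<phi> a = w}"] unfolding X_def by linarith
    moreover have "X \<subseteq> verts L" unfolding X_def N_def by blast
    ultimately have conn: "connected_graph (delete_verts L X)" using L unfolding triconn_def by blast
    have YG: "insert w Y \<subseteq> verts G" using VFG by blast
    have uX: "u \<notin> X" using u YG unfolding X_def N_def by blast
    \<comment> \<open>A walk from \<open>u\<close> in \<open>L - X\<close> cannot leave
      \<open>C\<close>: its next vertex is mapped into \<open>F\<close>, and could meet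
      \<open>G\<close> only in \<open>w\<close> or a leaf, which would put it into
      \<open>X\<close>.\<close>
    have VCX: "v \<in> C" if v: "v \<in> verts L" "v \<notin> X" for v
    proof -
      have "(u, v) \<in> {(x, y). {x, y} \<in> edges (delete_verts L X)}\<^sup>*"
        using conn u uX v unfolding connected_graph_def delete_verts_def by simp
      then show ?thesis
      proof induction
        case base show ?case unfolding C_def by simp
      next
        case (step y z)
        have yz: "{y, z} \<in> edges L" "z \<notin> X" using step(2) unfolding delete_verts_def by auto
        have z: "z \<in> verts L" using simple_edgeD[OF sim yz(1)] by blast
        have "\<phi> z \<noteq> w" "\<phi> z \<notin> Y" using yz z step(3) unfolding X_def N_def by auto
        then have zG: "\<phi> z \<notin> verts G" using CF(2)[OF step(3) yz(1)] VFG by blast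
        have y: "\<phi> y \<notin> verts G" "\<phi> y \<noteq> w" using CD[OF step(3)] YG by auto
        have "(y, z) \<in> Q'"
          using yz(1) CF(1)[OF step(3) yz(1)] zG y \<open>\<phi> z \<noteq> w\<close> unfolding Q'_def Q_def by simp
        then show ?case using step(3) unfolding C_def by (simp add: rtrancl.rtrancl_into_rtrancl)
      qed
    qed
    have "\<phi> v \<in> verts F" if "v \<in> verts L" for v
    proof (cases "v \<in> X")
      case True then show ?thesis using VFG unfolding X_def N_def by blast
    next
      case False then show ?thesis using CD[OF VCX[OF that False]] \<phi>V[OF that] by blast
    qed
    moreover have "\<phi> ` e \<in> edges F" if e: "e \<in> edges L" for e
    proof (rule ccontr)
      assume nF: "\<phi> ` e \<notin> edges F"
      then have eG: "\<phi> ` e \<subseteq> verts G" using \<phi>E[OF e] simple_edge_subset[OF simG] by blast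
      obtain a b where ab: "e = {a, b}" "a \<noteq> b" "a \<in> verts L" "b \<in> verts L"
        by (rule simple_edgeE[OF sim e])
      \<comment> \<open>Both ends are mapped into \<open>G\<close>, hence lie outside
        \<open>C\<close> and so in \<open>X\<close>. Since \<open>N\<close> has at most one element,
        the image is an edge of the star, which belongs to \<open>F\<close> too.\<close>
      have "a \<in> X" "b \<in> X" using ab eG VCX CD by blast+
      moreover have "\<phi> a \<noteq> \<phi> b" using ab inj_onD[OF inj] by blast
      ultimately have "(\<phi> a = w \<and> \<phi> b \<in> Y) \<or> (\<phi> b = w \<and> \<phi> a \<in> Y)"
        using Nuniq[of a b] ab(2) unfolding X_def N_def by auto
      then have "\<phi> ` e \<in> edges F" using wy(1)[of "\<phi> a"] wy(1)[of "\<phi> b"] ab(1) by (auto simp: insert_commute[of "\<phi> a"])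
      then show False using nF by blast
    qed
    ultimately show ?thesis using inj unfolding emb_def by blast
  qed
qed

text \<open>Agreement on the star makes the union of the two colourings well defined. Every copy
  lies on one side, so none becomes monochromatic.\<close>

lemma amalgam_good:
  assumes am: "amalgam D F G w Y" and L: "triconn L" and D: "(card (verts L))\<^sup>2 \<le> D"
    and c: "good q L F c" and d: "good q L G d" and cd: "\<And>y. y \<in> Y \<Longrightarrow> c {w, y} = d {w, y}"
  obtains b where "good q L (graph_union F G) b"
    "\<And>e. e \<in> edges F \<Longrightarrow> b e = c e" "\<And>e. e \<in> edges G \<Longrightarrow> b e = d e"
proof -
  define b where "b e = (if e \<in> edges F then c e else d e)" for e
  have D0: "0 < D" by (rule triconn_bound_pos[OF L D])
  have bF: "b e = c e" if "e \<in> edges F" for e using that unfolding b_def by simp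
  have bG: "b e = d e" if e: "e \<in> edges G" for e
  proof (cases "e \<in> edges F")
    case True
    then have "e \<subseteq> insert w Y"
      using simple_edge_subset e am unfolding amalgam_def by (metis Int_subset_iff)
    then obtain y where "y \<in> Y" "e = {w, y}" using amalgam_edge_in_F[OF am D0 True] by blast
    then show ?thesis using cd bF[OF True] by simp
  qed (simp add: b_def)
  have "good q L (graph_union F G) b"
  proof -
    have "b ` edges (graph_union F G) \<subseteq> {..<q}"
      using bF bG c d unfolding good_def graph_union_def by fastforce
    moreover have "\<not> (\<exists>i<q. \<forall>e\<in>edges L. b (\<phi> ` e) = i)" if \<phi>: "emb \<phi> L (graph_union F G)" for \<phi>
    proof -
      consider "emb \<phi> L F" | "emb \<phi> L G" using amalgam_emb[OF am L D \<phi>] by blast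
      then show ?thesis
      proof cases
        case 1
        then have "\<forall>e\<in>edges L. b (\<phi> ` e) = c (\<phi> ` e)" using bF unfolding emb_def by blast
        then show ?thesis using c 1 unfolding good_def by simp
      next
        case 2
        then have "\<forall>e\<in>edges L. b (\<phi> ` e) = d (\<phi> ` e)" using bG unfolding emb_def by blast
        then show ?thesis using d 2 unfolding good_def by simp
      qed
    qed
    ultimately show ?thesis unfolding good_def by blast
  qed
  then show thesis using that bF bG by blast
qed

section \<open>Attaching a renamed graph\<close>


definition image_graph :: "('a \<Rightarrow> 'b) \<Rightarrow> 'a graph \<Rightarrow> 'b graph" where
  "image_graph \<phi> G = (\<phi> ` verts G, (`) \<phi> ` edges G)"

text \<open>The leaves may be far apart on either side. Copies filling hyperedges rely on distances
  in \<open>F\<close>, whereas senders bring the distance with them as \<open>G\<close>.\<close>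

definition attached :: "nat \<Rightarrow> 'b graph \<Rightarrow> 'a graph \<Rightarrow> 'a \<Rightarrow> 'a set \<Rightarrow> ('a \<Rightarrow> 'b) \<Rightarrow> bool" where
  "attached D F G r J \<phi> \<longleftrightarrow> simple_graph F \<and> simple_graph G \<and> r \<in> verts G \<and> inj_on \<phi> (verts G) \<and>
     (\<forall>y\<in>J. {r, y} \<in> edges G \<and> {\<phi> r, \<phi> y} \<in> edges F) \<and>
     \<phi> ` verts G \<inter> verts F = insert (\<phi> r) (\<phi> ` J) \<and>
     ((\<forall>x\<in>J. \<forall>y\<in>J. x \<noteq> y \<longrightarrow> far D F (\<phi> r) (\<phi> x) (\<phi> y)) \<or>
      (\<forall>x\<in>J. \<forall>y\<in>J. x \<noteq> y \<longrightarrow> far D G r x y))"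

lemma image_graph_simple: "simple_graph G \<Longrightarrow> inj_on \<phi> (verts G) \<Longrightarrow> simple_graph (image_graph \<phi> G)"
  unfolding image_graph_def by (rule simple_image)

lemma graph_union_simple: "simple_graph F \<Longrightarrow> simple_graph G \<Longrightarrow> simple_graph (graph_union F G)"
  by (rule simple_graphI) (auto simp: graph_union_def simple_graph_def elim!: simple_edgeE[unfolded simple_graph_def, OF conjI])

lemma graph_union_commute: "graph_union F G = graph_union G F"
  unfolding graph_union_def by blast

lemma image_graph_edgeD:
  assumes G: "simple_graph G" and inj: "inj_on \<phi> (verts G)" and u: "u \<in> verts G"
    and e: "{\<phi> u, b} \<in> edges (image_graph \<phi> G)"
  obtains v where "b = \<phi> v" "v \<in> verts G" "{u, v} \<in> edges G"
proof -
  obtain f where f: "f \<in> edges G" "\<phi> ` f = {\<phi> u, b}" using e unfolding image_graph_def by auto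
  obtain x y where xy: "f = {x, y}" "x \<in> verts G" "y \<in> verts G" by (rule simple_edgeE[OF G f(1)])
  then have "{\<phi> x, \<phi> y} = {\<phi> u, b}" using f(2) by simp
  then have "(\<phi> x = \<phi> u \<and> b = \<phi> y) \<or> (\<phi> y = \<phi> u \<and> b = \<phi> x)" by (metis doubleton_eq_iff)
  then have "(x = u \<and> b = \<phi> y) \<or> (y = u \<and> b = \<phi> x)" using inj_onD[OF inj] xy u by metis
  then show thesis using that xy f(1) by (metis insert_commute)
qed

lemma far_image:
  assumes G: "simple_graph G" and inj: "inj_on \<phi> (verts G)"
    and V: "x \<in> verts G" "y \<in> verts G" "r \<in> verts G" and far: "far D G r x y"
  shows "far D (image_graph \<phi> G) (\<phi> r) (\<phi> x) (\<phi> y)"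
proof -
  have *: "\<exists>v\<in>verts G. z = \<phi> v \<and> (x, v) \<in> adj_avoiding G r ^^ m"
    if "(\<phi> x, z) \<in> adj_avoiding (image_graph \<phi> G) (\<phi> r) ^^ m" for z m
    using that
  proof (induction m arbitrary: z)
    case 0 then show ?case using V by auto
  next
    case (Suc m)
    then obtain a where a: "(\<phi> x, a) \<in> adj_avoiding (image_graph \<phi> G) (\<phi> r) ^^ m"
      "(a, z) \<in> adj_avoiding (image_graph \<phi> G) (\<phi> r)" by auto
    obtain u where u: "u \<in> verts G" "a = \<phi> u" "(x, u) \<in> adj_avoiding G r ^^ m" using Suc.IH[OF a(1)] by blast
    have e: "{\<phi> u, z} \<in> edges (image_graph \<phi> G)" and ne: "\<phi> u \<noteq> \<phi> r" "z \<noteq> \<phi> r"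
      using a(2) u(2) unfolding adj_avoiding_def by auto
    obtain v where v: "z = \<phi> v" "v \<in> verts G" "{u, v} \<in> edges G"
      by (rule image_graph_edgeD[OF G inj u(1) e])
    have "(u, v) \<in> adj_avoiding G r" using v ne unfolding adj_avoiding_def by auto
    then show ?case using u(3) v by auto
  qed
  show ?thesis unfolding far_def
  proof (intro allI impI notI)
    fix m assume m: "m \<le> D" "(\<phi> x, \<phi> y) \<in> adj_avoiding (image_graph \<phi> G) (\<phi> r) ^^ m"
    then obtain v where "v \<in> verts G" "\<phi> y = \<phi> v" "(x, v) \<in> adj_avoiding G r ^^ m" using * by blast
    then show False using inj_onD[OF inj] V(2) far m(1) unfolding far_def by metis
  qed
qed

lemma attached_amalgam:
  assumes att: "attached D F G r J \<phi>"
  shows "amalgam D F (image_graph \<phi> G) (\<phi> r) (\<phi> ` J) \<or> amalgam D (image_graph \<phi> G) F (\<phi> r) (\<phi> ` J)"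
proof -
  have F: "simple_graph F" and G: "simple_graph G" and r: "r \<in> verts G" and inj: "inj_on \<phi> (verts G)"
    and J: "\<And>y. y \<in> J \<Longrightarrow> {r, y} \<in> edges G" "\<And>y. y \<in> J \<Longrightarrow> {\<phi> r, \<phi> y} \<in> edges F"
    and V: "\<phi> ` verts G \<inter> verts F = insert (\<phi> r) (\<phi> ` J)"
    and far: "(\<forall>x\<in>J. \<forall>y\<in>J. x \<noteq> y \<longrightarrow> far D F (\<phi> r) (\<phi> x) (\<phi> y)) \<or>
      (\<forall>x\<in>J. \<forall>y\<in>J. x \<noteq> y \<longrightarrow> far D G r x y)"
    using att unfolding attached_def by auto
  have JV: "y \<in> verts G" if "y \<in> J" for y using simple_edgeD[OF G J(1)[OF that]] by blast
  let ?I = "image_graph \<phi> G"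
  have I: "simple_graph ?I" by (rule image_graph_simple[OF G inj])
  have rJ: "\<phi> r \<notin> \<phi> ` J" using simple_edgeD(1)[OF F J(2)] by blast
  have "{\<phi> r, \<phi> y} \<in> edges ?I" if "y \<in> J" for y
    using imageI[OF J(1)[OF that], of "(`) \<phi>"] unfolding image_graph_def by simp
  then have e: "\<forall>y\<in>\<phi> ` J. {\<phi> r, y} \<in> edges F \<and> {\<phi> r, y} \<in> edges ?I" using J(2) by blast
  have V': "verts F \<inter> verts ?I = insert (\<phi> r) (\<phi> ` J)"
    using V unfolding image_graph_def by (simp add: Int_commute)
  from far show ?thesis
  proof
    assume "\<forall>x\<in>J. \<forall>y\<in>J. x \<noteq> y \<longrightarrow> far D F (\<phi> r) (\<phi> x) (\<phi> y)"
    then have "\<forall>x\<in>\<phi> ` J. \<forall>y\<in>\<phi> ` J. x \<noteq> y \<longrightarrow> far D F (\<phi> r) x y" by auto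
    then have "amalgam D F ?I (\<phi> r) (\<phi> ` J)" unfolding amalgam_def using F I rJ e V' by simp
    then show ?thesis ..
  next
    assume "\<forall>x\<in>J. \<forall>y\<in>J. x \<noteq> y \<longrightarrow> far D G r x y"
    then have "\<forall>x\<in>\<phi> ` J. \<forall>y\<in>\<phi> ` J. x \<noteq> y \<longrightarrow> far D ?I (\<phi> r) x y"
      using far_image[OF G inj JV JV r] by (simp, metis)
    then have "amalgam D ?I F (\<phi> r) (\<phi> ` J)"
      unfolding amalgam_def using F I rJ e V' by (simp add: Int_commute)
    then show ?thesis ..
  qed
qed

lemma attached_good:
  assumes att: "attached D F G r J \<phi>" and L: "triconn L" and D: "(card (verts L))\<^sup>2 \<le> D"
    and c: "good q L F c" and d: "good q L G d" and cd: "\<And>y. y \<in> J \<Longrightarrow> c {\<phi> r, \<phi> y} = d {r, y}"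
  obtains b where "good q L (graph_union F (image_graph \<phi> G)) b"
    "\<And>e. e \<in> edges F \<Longrightarrow> b e = c e" "\<And>e. e \<in> edges G \<Longrightarrow> b (\<phi> ` e) = d e"
proof -
  have G: "simple_graph G" and r: "r \<in> verts G" and inj: "inj_on \<phi> (verts G)"
    and J: "\<And>y. y \<in> J \<Longrightarrow> {r, y} \<in> edges G"
    using att unfolding attached_def by auto
  let ?\<psi> = "inv_into (verts G) \<phi>" and ?I = "image_graph \<phi> G"
  have inv: "?\<psi> ` \<phi> ` e = e" if "e \<in> edges G" for e
    using inj simple_edge_subset[OF G that] by (rule inv_into_image_cancel)
  have "emb ?\<psi> ?I G"
    unfolding emb_def image_graph_def using inj inv by (auto simp: inj_on_inv_into inv_into_into)
  then have d': "good q L ?I (\<lambda>e. d (?\<psi> ` e))" using d by (rule good_pullback)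
  have cd': "c {\<phi> r, y} = d (?\<psi> ` {\<phi> r, y})" if y: "y \<in> \<phi> ` J" for y
  proof -
    obtain x where x: "x \<in> J" "y = \<phi> x" using y by blast
    then show ?thesis using cd[OF x(1)] inv[OF J[OF x(1)]] by simp
  qed
  obtain b where b: "good q L (graph_union F ?I) b"
    "\<And>e. e \<in> edges F \<Longrightarrow> b e = c e" "\<And>e. e \<in> edges ?I \<Longrightarrow> b e = d (?\<psi> ` e)"
    using attached_amalgam[OF att]
  proof
    assume am: "amalgam D F ?I (\<phi> r) (\<phi> ` J)"
    show thesis by (rule amalgam_good[OF am L D c d' cd']) (auto intro: that)
  next
    assume am: "amalgam D ?I F (\<phi> r) (\<phi> ` J)"
    show thesis by (rule amalgam_good[OF am L D d' c cd'[symmetric]])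
        (auto intro: that simp: graph_union_commute[of F])
  qed
  show thesis
  proof (rule that[OF b(1,2)])
    fix e assume e: "e \<in> edges G"
    then have "\<phi> ` e \<in> edges ?I" unfolding image_graph_def by simp
    then show "b (\<phi> ` e) = d e" using b(3) inv[OF e] by simp
  qed
qed

lemma attached_emb: "attached D F G r J \<phi> \<Longrightarrow> emb \<phi> G (graph_union F (image_graph \<phi> G))"
  unfolding attached_def emb_def graph_union_def image_graph_def by auto

lemma attached_simple: "attached D F G r J \<phi> \<Longrightarrow> simple_graph (graph_union F (image_graph \<phi> G))"
  unfolding attached_def by (meson graph_union_simple image_graph_simple)

text \<open>Look at the last visit of the walk to the copy of \<open>G\<close>: it takes place at a
  shared leaf, and from there on the walk runs in \<open>F\<close>. So reaching \<open>z\<close>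
  from the copy is no shorter than reaching it in \<open>F\<close> from some shared leaf.\<close>

lemma attached_path:
  assumes att: "attached D F G r J \<phi>" and z: "z \<in> verts F" "z \<notin> \<phi> ` verts G"
    and path: "(p, z) \<in> adj_avoiding (graph_union F (image_graph \<phi> G)) (\<phi> r) ^^ n"
  shows "(\<exists>y\<in>J. \<exists>m\<le>n. (\<phi> y, z) \<in> adj_avoiding F (\<phi> r) ^^ m) \<or>
    (p \<in> verts F \<and> p \<notin> \<phi> ` verts G \<and> (p, z) \<in> adj_avoiding F (\<phi> r) ^^ n)"
  using path
proof (induction n arbitrary: p)
  case 0
  then show ?case using z by auto
next
  case (Suc n)
  let ?U = "graph_union F (image_graph \<phi> G)"
  have F: "simple_graph F" and G: "simple_graph G" and inj: "inj_on \<phi> (verts G)"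
    and V: "\<phi> ` verts G \<inter> verts F = insert (\<phi> r) (\<phi> ` J)"
    using att unfolding attached_def by auto
  obtain s where s: "(p, s) \<in> adj_avoiding ?U (\<phi> r)" "(s, z) \<in> adj_avoiding ?U (\<phi> r) ^^ n"
    using relpow_Suc_D2[OF Suc.prems] by blast
  show ?case
    using Suc.IH[OF s(2)]
  proof
    assume "\<exists>y\<in>J. \<exists>m\<le>n. (\<phi> y, z) \<in> adj_avoiding F (\<phi> r) ^^ m"
    then show ?thesis by (meson le_SucI)
  next
    assume sz: "s \<in> verts F \<and> s \<notin> \<phi> ` verts G \<and> (s, z) \<in> adj_avoiding F (\<phi> r) ^^ n"
    have ps: "{p, s} \<in> edges ?U" "p \<noteq> \<phi> r" "s \<noteq> \<phi> r" using s(1) unfolding adj_avoiding_def by auto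
    have "{p, s} \<notin> edges (image_graph \<phi> G)"
      using sz simple_edgeD(3)[OF image_graph_simple[OF G inj]] unfolding image_graph_def by auto
    then have psF: "{p, s} \<in> edges F" using ps(1) unfolding graph_union_def by simp
    then have p: "p \<in> verts F" using simple_edgeD[OF F] by blast
    have "(p, s) \<in> adj_avoiding F (\<phi> r)" using psF ps unfolding adj_avoiding_def by simp
    then have path: "(p, z) \<in> adj_avoiding F (\<phi> r) ^^ Suc n" using sz by (blast intro: relpow_Suc_I2)
    show ?thesis
    proof (cases "p \<in> \<phi> ` verts G")
      case True
      then have "p \<in> \<phi> ` J" using p V ps(2) by auto
      then obtain y where y: "y \<in> J" "p = \<phi> y" by auto
      have "(\<phi> y, z) \<in> adj_avoiding F (\<phi> r) ^^ Suc n" using path y(2) by (simp only:)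
      then show ?thesis by (intro disjI1 bexI[OF _ y(1)] exI[of _ "Suc n"] conjI le_refl)
    next
      case False
      then show ?thesis using p path by simp
    qed
  qed
qed

lemma ex_attached:
  fixes F :: "nat graph" and G :: "'a graph"
  assumes F: "simple_graph F" and G: "simple_graph G" and r: "r \<in> verts G" and w: "w \<in> verts F"
    and J: "\<And>y. y \<in> J \<Longrightarrow> {r, y} \<in> edges G" "\<And>y. y \<in> J \<Longrightarrow> {w, g y} \<in> edges F"
    and g: "inj_on g J"
    and far: "(\<forall>x\<in>J. \<forall>y\<in>J. x \<noteq> y \<longrightarrow> far D F w (g x) (g y)) \<or>
      (\<forall>x\<in>J. \<forall>y\<in>J. x \<noteq> y \<longrightarrow> far D G r x y)"
  obtains \<phi> where "attached D F G r J \<phi>" "\<phi> r = w" "\<And>y. y \<in> J \<Longrightarrow> \<phi> y = g y"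
proof -
  have fin: "finite (verts G)" "finite (verts F)" using F G unfolding simple_graph_def by auto
  obtain f :: "'a \<Rightarrow> nat" where f: "inj_on f (verts G)" by (metis fin(1) finite_imp_inj_to_nat_seg)
  \<comment> \<open>Vertices outside the shared star receive names larger than every vertex of
    \<open>F\<close>.\<close>
  define \<phi> where "\<phi> v = (if v = r then w else if v \<in> J then g v else f v + Suc (Max (verts F)))" for v
  have new: "f v + Suc (Max (verts F)) \<notin> verts F" for v
    using Max_ge[OF fin(2), of "f v + Suc (Max (verts F))"] by auto
  have rJ: "r \<notin> J" using simple_edgeD(1)[OF G J(1)] by blast
  have wg: "g y \<noteq> w" "g y \<in> verts F" if "y \<in> J" for y using simple_edgeD[OF F J(2)[OF that]] by auto
  have JV: "J \<subseteq> verts G" using simple_edgeD(3)[OF G J(1)] by blast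
  have \<phi>r: "\<phi> r = w" unfolding \<phi>_def by simp
  have \<phi>J: "\<phi> y = g y" if "y \<in> J" for y using that rJ unfolding \<phi>_def by auto
  have \<phi>n: "\<phi> v \<notin> verts F" if "v \<notin> insert r J" for v using that new unfolding \<phi>_def by simp
  have "inj_on \<phi> (verts G)"
  proof (rule inj_onI)
    fix u v assume uv: "u \<in> verts G" "v \<in> verts G" "\<phi> u = \<phi> v"
    show "u = v"
    proof (cases "u \<in> insert r J")
      case True
      then have "\<phi> u \<in> verts F" using \<phi>r \<phi>J wg w by auto
      then have "v \<in> insert r J" using \<phi>n uv(3) by metis
      then show ?thesis using True uv(3) \<phi>r \<phi>J wg inj_onD[OF g] by (metis insertE)
    next
      case False
      then have "v \<notin> insert r J" using \<phi>n[OF False] uv(3) \<phi>r \<phi>J wg(2) w by auto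
      then have "f u = f v" using False uv(3) unfolding \<phi>_def by simp
      then show ?thesis using inj_onD[OF f] uv by blast
    qed
  qed
  moreover have "\<phi> ` verts G \<inter> verts F = insert (\<phi> r) (\<phi> ` J)"
  proof
    show "\<phi> ` verts G \<inter> verts F \<subseteq> insert (\<phi> r) (\<phi> ` J)" using \<phi>n by fastforce
    have "\<phi> ` J \<subseteq> verts F" using \<phi>J wg(2) by auto
    then show "insert (\<phi> r) (\<phi> ` J) \<subseteq> \<phi> ` verts G \<inter> verts F" using \<phi>r w r JV by blast
  qed
  moreover have "(\<forall>x\<in>J. \<forall>y\<in>J. x \<noteq> y \<longrightarrow> far D F (\<phi> r) (\<phi> x) (\<phi> y)) \<or>
      (\<forall>x\<in>J. \<forall>y\<in>J. x \<noteq> y \<longrightarrow> far D G r x y)"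
    using far \<phi>r \<phi>J by simp
  ultimately have "attached D F G r J \<phi>"
    unfolding attached_def using F G r J \<phi>r \<phi>J by simp
  then show thesis using that \<phi>r \<phi>J by blast
qed

section \<open>Sparse hypergraphs without proper 2-colouring\<close>


text \<open>Hyperedges are lists because their \<open>i\<close>-th entry will be identified with the
  \<open>i\<close>-th leaf of an attached graph.\<close>

definition hyper_adj :: "nat list list \<Rightarrow> (nat \<times> nat) set" where
  "hyper_adj hs = {(x, y). \<exists>zs\<in>set hs. x \<in> set zs \<and> y \<in> set zs}"

definition hyper_far :: "nat \<Rightarrow> nat list list \<Rightarrow> nat \<Rightarrow> nat \<Rightarrow> bool" where
  "hyper_far D hs x y \<longleftrightarrow> (\<forall>m\<le>D. (x, y) \<notin> hyper_adj hs ^^ m)"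

text \<open>Large girth in incremental form, matching the gluing of one copy per hyperedge: the head
  is the newest edge, and its entries are far apart in the hypergraph of the earlier ones.\<close>

primrec sparse :: "nat \<Rightarrow> nat list list \<Rightarrow> bool" where
  "sparse D [] \<longleftrightarrow> True"
| "sparse D (xs # hs) \<longleftrightarrow> sparse D hs \<and> sorted_wrt (hyper_far D hs) xs"

definition mono_on_edge :: "nat set \<Rightarrow> nat list \<Rightarrow> bool" where
  "mono_on_edge S xs \<longleftrightarrow> set xs \<subseteq> S \<or> set xs \<inter> S = {}"

definition hyper_degree :: "nat list list \<Rightarrow> nat \<Rightarrow> nat" where
  "hyper_degree hs x = length (filter (\<lambda>zs. x \<in> set zs) hs)"

text \<open>A 2-colouring of the vertices is encoded by one of its two classes.\<close>

definition proper_sets :: "nat \<Rightarrow> nat list list \<Rightarrow> nat set set" where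
  "proper_sets n hs = {S. S \<subseteq> {..<n} \<and> (\<forall>xs\<in>set hs. \<not> mono_on_edge S xs)}"

text \<open>Greedy choice from the back: each of the fewer than \<open>K\<close> entries already
  chosen excludes at most \<open>b\<close> candidates for the next one.\<close>

lemma card_sorted_wrt_lists:
  assumes U: "finite U" and b: "\<And>y. y \<in> U \<Longrightarrow> card {x \<in> U. \<not> P x y} \<le> b" and "k \<le> K"
  shows "(card U - K * b) ^ k \<le> card {xs. length xs = k \<and> set xs \<subseteq> U \<and> sorted_wrt P xs}"
  using \<open>k \<le> K\<close>
proof (induction k)
  case 0
  have "{xs. length xs = 0 \<and> set xs \<subseteq> U \<and> sorted_wrt P xs} = {[]}" by auto
  then show ?case by simp
next
  case (Suc k)
  let ?S = "\<lambda>k. {xs. length xs = k \<and> set xs \<subseteq> U \<and> sorted_wrt P xs}"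
  let ?A = "\<lambda>ys. {x \<in> U. \<forall>y\<in>set ys. P x y}"
  have fin: "finite (?S k)" for k
    by (rule finite_subset[OF _ finite_lists_length_eq[OF U, of k]]) auto
  have A: "card U - K * b \<le> card (?A ys)" if ys: "ys \<in> ?S k" for ys
  proof -
    let ?B = "\<Union>y\<in>set ys. {x \<in> U. \<not> P x y}"
    have "card ?B \<le> (\<Sum>y\<in>set ys. card {x \<in> U. \<not> P x y})" by (rule card_UN_le) simp
    also have "\<dots> \<le> (\<Sum>y\<in>set ys. b)" using ys b by (intro sum_mono) auto
    also have "\<dots> \<le> K * b" using ys card_length[of ys] Suc.prems by simp
    finally have "card ?B \<le> K * b" .
    moreover have "card U - card ?B \<le> card (U - ?B)" by (rule diff_card_le_card_Diff) (use U in auto)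
    moreover have "U - ?B = ?A ys" by blast
    ultimately show ?thesis by simp
  qed
  have eq: "?S (Suc k) = (\<lambda>(ys, x). x # ys) ` (SIGMA ys:?S k. ?A ys)" (is "?L = ?R")
  proof
    show "?L \<subseteq> ?R"
    proof
      fix xs assume "xs \<in> ?L"
      then obtain x ys where "xs = x # ys" "ys \<in> ?S k" "x \<in> ?A ys"
        by (cases xs) auto
      then show "xs \<in> ?R" by (auto intro!: image_eqI[of _ _ "(ys, x)"])
    qed
  qed auto
  have "(card U - K * b) ^ Suc k \<le> (card U - K * b) * card (?S k)"
    using Suc by simp
  also have "\<dots> = (\<Sum>ys\<in>?S k. card U - K * b)" by simp
  also have "\<dots> \<le> (\<Sum>ys\<in>?S k. card (?A ys))" using A by (intro sum_mono) blast
  also have "\<dots> = card (SIGMA ys:?S k. ?A ys)"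
    by (rule card_SigmaI[symmetric]) (use fin U in auto)
  also have "\<dots> = card (?S (Suc k))"
    unfolding eq by (rule card_image[symmetric]) (auto simp: inj_on_def)
  finally show ?case .
qed

lemma card_relpow_le:
  fixes R :: "('a \<times> 'a) set"
  assumes "\<And>y. finite {x. (x, y) \<in> R} \<and> card {x. (x, y) \<in> R} \<le> d"
  shows "finite {x. (x, y) \<in> R ^^ m} \<and> card {x. (x, y) \<in> R ^^ m} \<le> d ^ m"
proof (induction m arbitrary: y)
  case 0
  have "{x. (x, y) \<in> R ^^ 0} = {y}" by auto
  then show ?case by simp
next
  case (Suc m)
  have eq: "{x. (x, y) \<in> R ^^ Suc m} = (\<Union>z\<in>{z. (z, y) \<in> R}. {x. (x, z) \<in> R ^^ m})" by auto
  have "card {x. (x, y) \<in> R ^^ Suc m} \<le> (\<Sum>z\<in>{z. (z, y) \<in> R}. card {x. (x, z) \<in> R ^^ m})"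
    unfolding eq using assms[of y] by (intro card_UN_le) blast
  also have "\<dots> \<le> (\<Sum>z\<in>{z. (z, y) \<in> R}. d ^ m)" using Suc by (intro sum_mono) blast
  also have "\<dots> = card {z. (z, y) \<in> R} * d ^ m" by simp
  also have "\<dots> \<le> d * d ^ m" using assms[of y] by (intro mult_right_mono) auto
  finally have "card {x. (x, y) \<in> R ^^ Suc m} \<le> d ^ Suc m" by simp
  moreover have "finite {x. (x, y) \<in> R ^^ Suc m}" unfolding eq using Suc assms[of y] by blast
  ultimately show ?case by blast
qed

text \<open>These vertices lie in a ball of radius \<open>D\<close> around \<open>y\<close>. A
  vertex is in at most \<open>d\<close> edges of \<open>k\<close> entries each, which gives at most
  \<open>d * k\<close> neighbours per step.\<close>

lemma card_not_hyper_far_le: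
  assumes k: "\<And>xs. xs \<in> set hs \<Longrightarrow> length xs = k" and d: "\<And>x. hyper_degree hs x \<le> d"
  shows "card {x \<in> U. \<not> hyper_far D hs x y} \<le> (\<Sum>m\<le>D. (d * k) ^ m)"
proof -
  have step: "finite {x. (x, z) \<in> hyper_adj hs} \<and> card {x. (x, z) \<in> hyper_adj hs} \<le> d * k" for z
  proof -
    let ?T = "set (filter (\<lambda>zs. z \<in> set zs) hs)"
    have eq: "{x. (x, z) \<in> hyper_adj hs} = (\<Union>zs\<in>?T. set zs)" unfolding hyper_adj_def by auto
    have "card (\<Union>zs\<in>?T. set zs) \<le> (\<Sum>zs\<in>?T. card (set zs))" by (rule card_UN_le) simp
    also have "\<dots> \<le> (\<Sum>zs\<in>?T. k)" using k card_length by (intro sum_mono) fastforce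
    also have "\<dots> = card ?T * k" by simp
    also have "\<dots> \<le> d * k"
      using card_length[of "filter (\<lambda>zs. z \<in> set zs) hs"] d[of z] unfolding hyper_degree_def
      by (intro mult_right_mono) linarith+
    finally show ?thesis unfolding eq by simp
  qed
  have fin: "finite {x. (x, y) \<in> hyper_adj hs ^^ m}" for m
    using card_relpow_le[OF step] by blast
  have "{x \<in> U. \<not> hyper_far D hs x y} \<subseteq> (\<Union>m\<in>{..D}. {x. (x, y) \<in> hyper_adj hs ^^ m})"
    unfolding hyper_far_def by blast
  then have "card {x \<in> U. \<not> hyper_far D hs x y} \<le> card (\<Union>m\<in>{..D}. {x. (x, y) \<in> hyper_adj hs ^^ m})"
    using fin by (intro card_mono) auto
  also have "\<dots> \<le> (\<Sum>m\<le>D. card {x. (x, y) \<in> hyper_adj hs ^^ m})" by (rule card_UN_le) simp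
  also have "\<dots> \<le> (\<Sum>m\<le>D. (d * k) ^ m)" using card_relpow_le[OF step] by (intro sum_mono) blast
  finally show ?thesis .
qed

lemma sum_hyper_degree_le:
  assumes "\<And>xs. xs \<in> set hs \<Longrightarrow> length xs = k"
  shows "(\<Sum>x<n. hyper_degree hs x) \<le> k * length hs"
  using assms
proof (induction hs)
  case Nil
  then show ?case by (simp add: hyper_degree_def)
next
  case (Cons zs hs)
  have "(\<Sum>x<n. hyper_degree (zs # hs) x) = (\<Sum>x<n. (if x \<in> set zs then 1 else 0) + hyper_degree hs x)"
    by (rule sum.cong) (auto simp: hyper_degree_def)
  also have "\<dots> = card ({..<n} \<inter> set zs) + (\<Sum>x<n. hyper_degree hs x)"
    by (simp add: sum.distrib sum.If_cases)
  also have "card ({..<n} \<inter> set zs) \<le> card (set zs)" by (intro card_mono) auto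
  also have "card (set zs) \<le> k" using card_length[of zs] Cons.prems by simp
  finally show ?case using Cons by simp
qed

text \<open>Markov's inequality for degrees. Saturated vertices are barred from further edges, and
  this keeps their number small.\<close>

lemma card_saturated_le:
  assumes "\<And>xs. xs \<in> set hs \<Longrightarrow> length xs = k"
  shows "d * card {x. x < n \<and> d \<le> hyper_degree hs x} \<le> k * length hs"
proof -
  let ?T = "{x. x < n \<and> d \<le> hyper_degree hs x}"
  have "d * card ?T = (\<Sum>x\<in>?T. d)" by simp
  also have "\<dots> \<le> (\<Sum>x\<in>?T. hyper_degree hs x)" by (intro sum_mono) simp
  also have "\<dots> \<le> (\<Sum>x<n. hyper_degree hs x)" by (intro sum_mono2) auto
  also have "\<dots> \<le> k * length hs" by (rule sum_hyper_degree_le) (rule assms)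
  finally show ?thesis .
qed

lemma finite_proper_sets: "finite (proper_sets n hs)"
  by (rule finite_subset[of _ "Pow {..<n}"]) (auto simp: proper_sets_def)

text \<open>
  Averaging over the admissible edges: every 2-colouring makes at least one in \<open>4 ^ k\<close> of
  them monochromatic, so some edge destroys that fraction of the surviving 2-colourings.
\<close>
lemma sparse_extend:
  fixes k D N d b n :: nat
  assumes k: "1 \<le> k" and N: "N = 4 ^ k" and d: "d = 3 * k * N"
    and b: "b = (\<Sum>m\<le>D. (d * k) ^ m)" and n: "n = 12 * k * b"
    and hs: "\<And>xs. xs \<in> set hs \<Longrightarrow> length xs = k" "\<And>x. hyper_degree hs x \<le> d" "length hs \<le> N * n"
  obtains xs where "length xs = k" "\<And>x. x \<in> set xs \<Longrightarrow> x < n \<and> hyper_degree hs x < d"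
    "sorted_wrt (hyper_far D hs) xs"
    "N * card (proper_sets n (xs # hs)) \<le> (N - 1) * card (proper_sets n hs)"
proof -
  define T where "T = {x. x < n \<and> d \<le> hyper_degree hs x}"
  define U where "U = {..<n} - T"
  define A where "A = {xs. length xs = k \<and> set xs \<subseteq> U \<and> sorted_wrt (hyper_far D hs) xs}"
  define C where "C = proper_sets n hs"
  have finU: "finite U" unfolding U_def by simp
  have finC: "finite C" unfolding C_def by (rule finite_proper_sets)
  have finA: "finite A"
    by (rule finite_subset[OF _ finite_lists_length_eq[OF finU, of k]]) (auto simp: A_def)
  have N0: "0 < N" unfolding N by simp
  have b0: "1 \<le> b" unfolding b by (simp add: sum.atMost_shift)
  \<comment> \<open>The choice \<open>d = 3 * k * N\<close> leaves at most a third of the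
    \<open>n = 12 * k * b\<close> vertices saturated, so \<open>U\<close> has at least
    \<open>8 * k * b\<close>.\<close>
  have "d * card T \<le> k * length hs" unfolding T_def by (rule card_saturated_le) (rule hs)
  also have "\<dots> \<le> k * (N * n)" using hs(3) by simp
  also have "\<dots> = d * (4 * k * b)" unfolding d n by simp
  finally have "card T \<le> 4 * k * b" using k N0 unfolding d by (simp add: mult.commute mult.left_commute)
  moreover have "card {..<n} - card T \<le> card U" unfolding U_def by (rule diff_card_le_card_Diff) (simp add: T_def)
  ultimately have U: "8 * k * b \<le> card U" unfolding n by simp
  have cA: "card A \<le> n ^ k"
  proof -
    have "A \<subseteq> {xs. set xs \<subseteq> {..<n} \<and> length xs = k}" unfolding A_def U_def by auto
    then have "card A \<le> card {xs. set xs \<subseteq> {..<n} \<and> length xs = k}"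
      by (intro card_mono finite_lists_length_eq) auto
    then show ?thesis by (simp add: card_lists_length_eq)
  qed
  \<comment> \<open>One class of \<open>S\<close> contains at least \<open>4 * k * b\<close>
    vertices of \<open>U\<close>. After the greedy losses, at most \<open>k * b\<close>, each entry
    still has \<open>3 * k * b = n / 4\<close> choices, hence \<open>N = 4 ^ k\<close>.\<close>
  have frac: "n ^ k \<le> N * card {xs \<in> A. mono_on_edge S xs}" for S
  proof -
    have "card U = card (U \<inter> S) + card (U - S)" using finU by (rule card_Int_Diff)
    then have "4 * k * b \<le> card (U \<inter> S) \<or> 4 * k * b \<le> card (U - S)" using U by linarith
    then obtain W where W: "W \<subseteq> U" "W \<subseteq> S \<or> W \<inter> S = {}" "4 * k * b \<le> card W"
      using that[of "U \<inter> S"] that[of "U - S"] by auto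
    have finW: "finite W" using W(1) finU by (rule finite_subset)
    have "card {x \<in> W. \<not> hyper_far D hs x y} \<le> b" for y
      unfolding b by (rule card_not_hyper_far_le[OF hs(1,2)])
    then have "(card W - k * b) ^ k \<le> card {xs. length xs = k \<and> set xs \<subseteq> W \<and> sorted_wrt (hyper_far D hs) xs}"
      using finW by (intro card_sorted_wrt_lists) auto
    also have "\<dots> \<le> card {xs \<in> A. mono_on_edge S xs}"
    proof (rule card_mono)
      show "finite {xs \<in> A. mono_on_edge S xs}" using finA by simp
      show "{xs. length xs = k \<and> set xs \<subseteq> W \<and> sorted_wrt (hyper_far D hs) xs} \<subseteq> {xs \<in> A. mono_on_edge S xs}"
        using W(1,2) unfolding A_def mono_on_edge_def by blast
    qed
    finally have 1: "(card W - k * b) ^ k \<le> card {xs \<in> A. mono_on_edge S xs}" .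
    have "3 * k * b \<le> card W - k * b" using W(3) by simp
    then have "(3 * k * b) ^ k \<le> (card W - k * b) ^ k" by (rule power_mono) simp
    then have "N * (3 * k * b) ^ k \<le> N * card {xs \<in> A. mono_on_edge S xs}" using 1 by simp
    moreover have "n = 4 * (3 * k * b)" unfolding n by simp
    then have "n ^ k = N * (3 * k * b) ^ k" unfolding N by (simp only: power_mult_distrib)
    ultimately show ?thesis by simp
  qed
  have n0: "0 < n ^ k" using k b0 unfolding n by simp
  have "A \<noteq> {}"
  proof
    assume "A = {}"
    then show False using frac[of "{}"] n0 by simp
  qed
  have "\<exists>xs\<in>A. card C \<le> N * card {S \<in> C. mono_on_edge S xs}"
  proof (rule ccontr)
    assume "\<not> ?thesis"
    then have less: "N * card {S \<in> C. mono_on_edge S xs} < card C" if "xs \<in> A" for xs using that by auto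
    \<comment> \<open>Pairs of a colouring \<open>S\<close> and an edge \<open>xs\<close>
      monochromatic under it are counted in two ways: \<open>frac\<close> bounds their number from
      below for each \<open>S\<close>, and \<open>less\<close> from above for each
      \<open>xs\<close>.\<close>
    have "card A * card C \<le> (\<Sum>S\<in>C. N * card {xs \<in> A. mono_on_edge S xs})"
    proof -
      have "(\<Sum>S\<in>C. card A) \<le> (\<Sum>S\<in>C. N * card {xs \<in> A. mono_on_edge S xs})"
        using cA frac order_trans by (intro sum_mono) blast
      then show ?thesis by (simp add: mult.commute)
    qed
    also have "\<dots> = N * (\<Sum>S\<in>C. \<Sum>xs\<in>{xs \<in> A. mono_on_edge S xs}. 1)" by (simp add: sum_distrib_left)
    also have "(\<Sum>S\<in>C. \<Sum>xs\<in>{xs \<in> A. mono_on_edge S xs}. 1) =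
        (\<Sum>xs\<in>A. \<Sum>S\<in>{S \<in> C. mono_on_edge S xs}. 1 :: nat)"
      by (rule sum.swap_restrict[OF finC finA])
    also have "N * \<dots> = (\<Sum>xs\<in>A. N * card {S \<in> C. mono_on_edge S xs})" by (simp add: sum_distrib_left)
    also have "\<dots> < (\<Sum>xs\<in>A. card C)" using less finA \<open>A \<noteq> {}\<close> by (intro sum_strict_mono) auto
    finally show False by simp
  qed
  then obtain xs where xs: "xs \<in> A" "card C \<le> N * card {S \<in> C. mono_on_edge S xs}" by blast
  have "proper_sets n (xs # hs) = C - {S \<in> C. mono_on_edge S xs}"
    unfolding C_def proper_sets_def by auto
  then have "card (proper_sets n (xs # hs)) = card C - card {S \<in> C. mono_on_edge S xs}"
    using finC by (simp add: card_Diff_subset)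
  then have "N * card (proper_sets n (xs # hs)) = N * card C - N * card {S \<in> C. mono_on_edge S xs}"
    by (simp add: diff_mult_distrib2)
  also have "\<dots> \<le> N * card C - card C" using xs(2) by (rule diff_le_mono2)
  also have "\<dots> = (N - 1) * card C" by (simp add: diff_mult_distrib)
  finally have "N * card (proper_sets n (xs # hs)) \<le> (N - 1) * card (proper_sets n hs)" unfolding C_def .
  moreover have "x < n \<and> hyper_degree hs x < d" if "x \<in> set xs" for x
    using that xs(1) unfolding A_def U_def T_def by auto
  ultimately show thesis using that xs(1) unfolding A_def by blast
qed

text \<open>Bernoulli's inequality cleared of denominators: for positive \<open>a\<close>, (1 +
  1/a)^(a+1) is at least 1 + (a+1)/a, which exceeds 2. Thus \<open>N\<close> rounds with factor 1 -
  1/N more than halve a quantity.\<close>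

lemma two_power_less_Suc_power: "2 * a ^ Suc a < Suc a ^ Suc a"
proof -
  have *: "a ^ Suc m + Suc m * a ^ m \<le> Suc a ^ Suc m" for m
  proof (induction m)
    case (Suc m)
    have "a ^ Suc (Suc m) + Suc (Suc m) * a ^ Suc m \<le> Suc a * (a ^ Suc m + Suc m * a ^ m)"
      by (simp add: algebra_simps)
    also have "\<dots> \<le> Suc a * Suc a ^ Suc m" using Suc by (rule mult_le_mono2)
    finally show ?case by simp
  qed simp
  show ?thesis
  proof (cases "a = 0")
    case False
    then have "2 * a ^ Suc a < a ^ Suc a + Suc a * a ^ a" by simp
    then show ?thesis using *[of a] by linarith
  qed simp
qed

text \<open>Each new edge keeps at most a fraction 1 - 1/N of the proper 2-colourings. As
  \<open>N\<close> edges more than halve their number, \<open>N * n\<close> edges bring the initial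
  \<open>2 ^ n\<close> below 1.\<close>

lemma ex_sparse_hypergraph:
  fixes k D :: nat
  assumes k: "1 \<le> k"
  shows "\<exists>n hs. sparse D hs \<and> (\<forall>xs\<in>set hs. length xs = k \<and> set xs \<subseteq> {..<n}) \<and>
    (\<forall>S. \<exists>xs\<in>set hs. mono_on_edge S xs)"
proof -
  define N d where "N = (4 :: nat) ^ k" and "d = 3 * k * N"
  define b n where "b = (\<Sum>m\<le>D. (d * k) ^ m)" and "n = 12 * k * b"
  have N0: "0 < N" unfolding N_def by simp
  have "\<exists>hs. length hs = t \<and> sparse D hs \<and> (\<forall>xs\<in>set hs. length xs = k \<and> set xs \<subseteq> {..<n}) \<and>
      (\<forall>x. hyper_degree hs x \<le> d) \<and> N ^ t * card (proper_sets n hs) \<le> (N - 1) ^ t * 2 ^ n"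
    if "t \<le> N * n" for t
    using that
  proof (induction t)
    case 0
    have "proper_sets n [] = Pow {..<n}" unfolding proper_sets_def by auto
    then show ?case by (simp add: hyper_degree_def card_Pow)
  next
    case (Suc t)
    then obtain hs where hs: "length hs = t" "sparse D hs"
      "\<And>xs. xs \<in> set hs \<Longrightarrow> length xs = k \<and> set xs \<subseteq> {..<n}" "\<And>x. hyper_degree hs x \<le> d"
      "N ^ t * card (proper_sets n hs) \<le> (N - 1) ^ t * 2 ^ n" by auto
    obtain xs where xs: "length xs = k" "\<And>x. x \<in> set xs \<Longrightarrow> x < n \<and> hyper_degree hs x < d"
      "sorted_wrt (hyper_far D hs) xs"
      "N * card (proper_sets n (xs # hs)) \<le> (N - 1) * card (proper_sets n hs)"
      by (rule sparse_extend[OF k N_def d_def b_def n_def, of hs]) (use hs Suc.prems in auto)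
    have "N ^ Suc t * card (proper_sets n (xs # hs)) = N ^ t * (N * card (proper_sets n (xs # hs)))"
      by simp
    also have "\<dots> \<le> N ^ t * ((N - 1) * card (proper_sets n hs))" using xs(4) by (rule mult_le_mono2)
    also have "\<dots> = (N - 1) * (N ^ t * card (proper_sets n hs))" by simp
    also have "\<dots> \<le> (N - 1) * ((N - 1) ^ t * 2 ^ n)" using hs(5) by (rule mult_le_mono2)
    finally have "N ^ Suc t * card (proper_sets n (xs # hs)) \<le> (N - 1) ^ Suc t * 2 ^ n" by simp
    moreover have "hyper_degree (xs # hs) x \<le> d" for x
      using xs(2)[of x] hs(4)[of x] unfolding hyper_degree_def by auto
    ultimately show ?case
      using hs(1-3) xs(1-3) by (intro exI[of _ "xs # hs"]) auto
  qed
  from this[OF order_refl] obtain hs where hs: "sparse D hs"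
    "\<And>xs. xs \<in> set hs \<Longrightarrow> length xs = k \<and> set xs \<subseteq> {..<n}"
    "N ^ (N * n) * card (proper_sets n hs) \<le> (N - 1) ^ (N * n) * 2 ^ n" by auto
  have b0: "1 \<le> b" unfolding b_def by (simp add: sum.atMost_shift)
  have n0: "0 < n" using k b0 unfolding n_def by simp
  have "2 * (N - 1) ^ N < N ^ N" using two_power_less_Suc_power[of "N - 1"] N0 by simp
  then have "(2 * (N - 1) ^ N) ^ n < (N ^ N) ^ n" using n0 by (intro power_strict_mono) auto
  then have "(N - 1) ^ (N * n) * 2 ^ n < N ^ (N * n)"
    by (simp add: power_mult power_mult_distrib mult.commute)
  then have "card (proper_sets n hs) = 0" using hs(3) by (cases "card (proper_sets n hs)") auto
  then have none: "proper_sets n hs = {}" using finite_proper_sets by simp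
  have "\<exists>xs\<in>set hs. mono_on_edge S xs" for S
  proof -
    have "S \<inter> {..<n} \<notin> proper_sets n hs" using none by simp
    then obtain xs where "xs \<in> set hs" "mono_on_edge (S \<inter> {..<n}) xs" unfolding proper_sets_def by auto
    moreover from this have "mono_on_edge S xs" using hs(2) unfolding mono_on_edge_def by blast
    ultimately show ?thesis by blast
  qed
  then show ?thesis using hs(1,2) by blast
qed

section \<open>Negative senders\<close>


text \<open>By Ramsey's theorem a large complete graph has a monochromatic clique with as many
  vertices as \<open>L\<close>, and such a clique contains \<open>L\<close>.\<close>

lemma ex_ramsey_graph:
  assumes L: "simple_graph L"
  obtains G :: "nat graph" where "simple_graph G" "\<not> colourable q L G"
proof -
  let ?n = "card (verts L)"
  obtain N :: nat where N: "partn_lst {..<N} (replicate q ?n) 2" using ramsey_full by blast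
  let ?G = "complete_graph N"
  have "\<not> good q L ?G c" for c
  proof
    assume c: "good q L ?G c"
    then have "c \<in> nsets {..<N} 2 \<rightarrow> {..<length (replicate q ?n)}"
      unfolding good_def complete_graph_def by auto
    then obtain i where i: "i < q" "monochromatic {..<N} (replicate q ?n ! i) 2 c i"
      using N unfolding partn_lst_def by (metis length_replicate)
    then obtain S where S: "S \<in> nsets {..<N} ?n" "c ` nsets S 2 \<subseteq> {i}"
      unfolding monochromatic_def by auto
    have "finite (verts L)" using L unfolding simple_graph_def by blast
    moreover have "finite S" "card S = card (verts L)" "S \<subseteq> {..<N}" using S(1) unfolding nsets_def by auto
    ultimately obtain \<phi> where \<phi>: "bij_betw \<phi> (verts L) S" using finite_same_card_bij by metis
    have edge: "\<phi> ` e \<in> nsets S 2" if "e \<in> edges L" for e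
    proof -
      obtain u v where uv: "e = {u, v}" "u \<noteq> v" "u \<in> verts L" "v \<in> verts L" by (rule simple_edgeE[OF L \<open>e \<in> edges L\<close>])
      then have "\<phi> u \<noteq> \<phi> v" "\<phi> u \<in> S" "\<phi> v \<in> S" using \<phi> unfolding bij_betw_def inj_on_def by auto
      then show ?thesis using uv(1) unfolding nsets_2_eq by auto
    qed
    have "emb \<phi> L ?G"
      using \<phi> edge \<open>S \<subseteq> {..<N}\<close> nsets_mono[of S "{..<N}" 2] unfolding emb_def complete_graph_def bij_betw_def by auto
    moreover have "\<forall>e\<in>edges L. c (\<phi> ` e) = i" using edge S(2) by blast
    ultimately show False using c i(1) unfolding good_def by blast
  qed
  moreover have "simple_graph ?G" unfolding simple_graph_def complete_graph_def by simp
  ultimately show thesis using that unfolding colourable_def by blast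
qed

text \<open>
  The deleted edge of a minimal Ramsey graph can be coloured arbitrarily, and the monochromatic
  copy this creates uses a second edge at \<open>r\<close>.
\<close>
lemma ex_full_star:
  assumes L: "triconn L" and q: "0 < q"
  obtains G :: "nat graph" and r where "simple_graph G" "r \<in> verts G" "colourable q L G"
    "\<And>c i. good q L G c \<Longrightarrow> i < q \<Longrightarrow> \<exists>y. {r, y} \<in> edges G \<and> c {r, y} = i"
proof -
  have sim: "simple_graph L" using L by (rule triconn_simple)
  obtain R :: "nat graph" where "simple_graph R" "\<not> colourable q L R" by (rule ex_ramsey_graph[OF sim])
  then obtain M :: "nat graph" where M: "ramsey_minimal q M L"
    using ex_ramsey_minimal_subgraph[of R q L] ramsey_iff[OF sim, of q R] by auto
  have simM: "simple_graph M" and nM: "\<not> colourable q L M"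
    using M ramsey_iff[OF sim, of q M] unfolding ramsey_minimal_def by auto
  have "verts L \<noteq> {}" using L unfolding triconn_def by auto
  then obtain a b where ab: "{a, b} \<in> edges L" using triconn_neighbour[OF L] by blast
  have "edges M \<noteq> {}"
  proof
    assume "edges M = {}"
    then have "good q L M (\<lambda>_. 0)" using ab unfolding good_def emb_def by auto
    then show False using nM unfolding colourable_def by blast
  qed
  then obtain e where e: "e \<in> edges M" by blast
  obtain r y where ry: "e = {r, y}" "r \<noteq> y" "r \<in> verts M" "y \<in> verts M" by (rule simple_edgeE[OF simM e])
  define G where "G = (verts M, edges M - {e})"
  have "simple_graph G" using simM unfolding G_def simple_graph_def by auto
  moreover have "r \<in> verts G" using ry unfolding G_def by simp
  moreover have "colourable q L G"
  proof -
    have "subgraph G M" "G \<noteq> M" using \<open>simple_graph G\<close> e unfolding G_def subgraph_def by (auto simp: prod_eq_iff)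
    then show ?thesis using M ramsey_iff[OF sim, of q G] unfolding ramsey_minimal_def by blast
  qed
  moreover have "\<exists>y. {r, y} \<in> edges G \<and> c {r, y} = i" if c: "good q L G c" and i: "i < q" for c i
  proof -
    have "(c(e := i)) ` edges M \<subseteq> {..<q}" using c i unfolding good_def G_def by auto
    moreover have "\<not> good q L M (c(e := i))" using nM unfolding colourable_def by blast
    ultimately obtain \<phi> j where \<phi>: "emb \<phi> L M" "j < q" "\<forall>f\<in>edges L. (c(e := i)) (\<phi> ` f) = j"
      unfolding good_def by blast
    have "\<exists>f\<in>edges L. \<phi> ` f = e"
    proof (rule ccontr)
      assume none: "\<not> ?thesis"
      then have "emb \<phi> L G" using \<phi>(1) unfolding emb_def G_def by simp
      moreover have "\<forall>f\<in>edges L. c (\<phi> ` f) = j" using \<phi>(3) none by simp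
      ultimately show False using c \<phi>(2) unfolding good_def by blast
    qed
    then obtain f where f: "f \<in> edges L" "\<phi> ` f = e" by blast
    then have ji: "j = i" using \<phi>(3) by auto
    have "r \<in> \<phi> ` f" using f(2) ry(1) by simp
    then obtain x where x: "x \<in> f" "\<phi> x = r" by blast
    have xV: "x \<in> verts L" using simple_edge_subset[OF sim f(1)] x(1) by blast
    obtain u v where uv: "f = {u, v}" "u \<noteq> v" by (rule simple_edgeE[OF sim f(1)])
    then obtain x' where x': "f = {x, x'}" using x(1) by auto
    obtain z where z: "{x, z} \<in> edges L" "z \<noteq> x'" "z \<noteq> x" by (rule triconn_neighbour[OF L xV, of x'])
    have inj: "inj_on \<phi> (verts L)" using \<phi>(1) unfolding emb_def by blast
    have V: "z \<in> verts L" "x' \<in> verts L"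
      using simple_edgeD[OF sim z(1)] simple_edgeD[OF sim, of x x'] f(1) x' by auto
    have "\<phi> z \<noteq> \<phi> x'" "\<phi> z \<noteq> \<phi> x" using inj_onD[OF inj] V xV z by metis+
    then have ne: "{r, \<phi> z} \<noteq> e" using f(2) x' x(2) by (auto simp: doubleton_eq_iff)
    have im: "\<phi> ` {x, z} = {r, \<phi> z}" using x(2) by simp
    then have "{r, \<phi> z} \<in> edges M" using \<phi>(1) z(1) unfolding emb_def by metis
    moreover have "(c(e := i)) {r, \<phi> z} = i" using \<phi>(3) z(1) im ji by metis
    ultimately show ?thesis using ne unfolding G_def by (intro exI[of _ "\<phi> z"]) simp
  qed
  ultimately show thesis using that by blast
qed

section \<open>Senders from a failing identification\<close>

lemma relpow_sym:
  assumes "\<And>a b. (a, b) \<in> R \<Longrightarrow> (b, a) \<in> R" "(a, b) \<in> R ^^ m"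
  shows "(b, a) \<in> R ^^ m"
  using assms(2)
proof (induction m arbitrary: b)
  case (Suc m)
  then obtain c where "(a, c) \<in> R ^^ m" "(c, b) \<in> R" by auto
  then show ?case using Suc.IH assms(1) relpow_Suc_I2[of b c R a m] by blast
qed simp

lemma far_sym: "far D F w x y \<Longrightarrow> far D F w y x"
  unfolding far_def
  using relpow_sym[of "adj_avoiding F w" y x] by (auto simp: adj_avoiding_def insert_commute)

lemma hyper_far_sym: "hyper_far D hs x y \<Longrightarrow> hyper_far D hs y x"
  unfolding hyper_far_def
  using relpow_sym[of "hyper_adj hs" y x] by (auto simp: hyper_adj_def)

lemma sparse_hyper_far:
  assumes "sparse D (xs # hs)" "i < length xs" "j < length xs" "i \<noteq> j"
  shows "hyper_far D hs (xs ! i) (xs ! j)"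
proof -
  have "sorted_wrt (hyper_far D hs) xs" using assms(1) by simp
  then have "i < j \<Longrightarrow> hyper_far D hs (xs ! i) (xs ! j)" "j < i \<Longrightarrow> hyper_far D hs (xs ! j) (xs ! i)"
    using assms(2,3) by (auto simp: sorted_wrt_iff_nth_less)
  then show ?thesis using assms(4) hyper_far_sym by (meson linorder_neqE_nat)
qed

lemma far_neq: "far D F w x y \<Longrightarrow> x \<noteq> y"
  unfolding far_def by (metis relpow_0_I zero_le)

text \<open>The distance of the terminals is what permits attaching the sender elsewhere.
  Colourability supplies a colouring to extend there and keeps the inequalities from holding
  vacuously.\<close>

definition negative_sender :: "nat \<Rightarrow> nat \<Rightarrow> 'a graph \<Rightarrow> 'b graph \<Rightarrow> nat graph \<Rightarrow> nat \<Rightarrow> nat \<Rightarrow> nat \<Rightarrow> bool" where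
  "negative_sender q D L L' N r y y' \<longleftrightarrow> simple_graph N \<and> {r, y} \<in> edges N \<and> {r, y'} \<in> edges N \<and>
     far D N r y y' \<and> colourable q L N \<and> colourable q L' N \<and>
     (\<forall>c. good q L N c \<longrightarrow> c {r, y} \<noteq> c {r, y'}) \<and> (\<forall>c. good q L' N c \<longrightarrow> c {r, y} \<noteq> c {r, y'})"

text \<open>
  The vertices \<open>ys\<close> are identified with \<open>xs\<close> one after the other. Just before the first
  identification that destroys colourability, the next two vertices to be identified are the
  terminals of a negative sender: equal colours there would survive the identification.
\<close>
lemma attach_or_sender:
  fixes L :: "'a graph" and L' :: "'b graph" and F G :: "nat graph"
  assumes L: "triconn L" "(card (verts L))\<^sup>2 \<le> D" and L': "triconn L'" "(card (verts L'))\<^sup>2 \<le> D"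
    and equiv: "\<And>G :: nat graph. simple_graph G \<Longrightarrow> colourable q L G \<longleftrightarrow> colourable q L' G"
    and none: "\<nexists>N r y y'. negative_sender q D L L' N r y y'"
    and F: "simple_graph F" "colourable q L F" and G: "simple_graph G" "colourable q L G"
    and r: "r \<in> verts G" and w: "w \<in> verts F"
    and ys: "distinct ys" "\<And>y. y \<in> set ys \<Longrightarrow> {r, y} \<in> edges G"
    and xs: "length xs = length ys" "\<And>x. x \<in> set xs \<Longrightarrow> {w, x} \<in> edges F"
    and far: "\<And>i j. i < length xs \<Longrightarrow> j < length xs \<Longrightarrow> i \<noteq> j \<Longrightarrow> far D F w (xs ! i) (xs ! j)"
  obtains \<phi> where "attached D F G r (set ys) \<phi>" "\<phi> r = w" "\<And>i. i < length ys \<Longrightarrow> \<phi> (ys ! i) = xs ! i"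
    "colourable q L (graph_union F (image_graph \<phi> G))"
proof -
  have xsn: "xs ! i \<noteq> xs ! j" if "i < length ys" "j < length ys" "i \<noteq> j" for i j
    using far_neq[OF far] that xs(1) by metis
  \<comment> \<open>For each \<open>j\<close> the copy is renamed afresh, so the gluings along
    \<open>j\<close> and \<open>Suc j\<close> leaves need not have names in common outside
    \<open>F\<close>.\<close>
  have att: "\<exists>\<phi>. attached D F G r (set (take j ys)) \<phi> \<and> \<phi> r = w \<and> (\<forall>i<j. \<phi> (ys ! i) = xs ! i)"
    if j: "j \<le> length ys" for j
  proof -
    define g where "g y = the (map_of (zip ys xs) y)" for y
    have g: "g (ys ! i) = xs ! i" if "i < length ys" for i
      unfolding g_def using map_of_zip_nth[OF xs(1)[symmetric] ys(1)] that xs(1) by simp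
    have J: "\<exists>i<j. y = ys ! i" if "y \<in> set (take j ys)" for y
      using that j by (auto simp: in_set_conv_nth)
    have inj: "inj_on g (set (take j ys))"
    proof (rule inj_onI)
      fix x y assume xy: "x \<in> set (take j ys)" "y \<in> set (take j ys)" "g x = g y"
      obtain a b where "a < j" "x = ys ! a" "b < j" "y = ys ! b" using J xy(1,2) by blast
      then show "x = y" using xy(3) g xsn[of a b] j by (cases "a = b") auto
    qed
    have farJ: "\<forall>x\<in>set (take j ys). \<forall>y\<in>set (take j ys). x \<noteq> y \<longrightarrow> far D F w (g x) (g y)"
    proof (intro ballI impI)
      fix x y assume xy: "x \<in> set (take j ys)" "y \<in> set (take j ys)" "x \<noteq> y"
      obtain a b where "a < j" "x = ys ! a" "b < j" "y = ys ! b" using J xy(1,2) by blast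
      then show "far D F w (g x) (g y)" using far[of a b] xs(1) j g xy(3) by auto
    qed
    have e1: "{r, y} \<in> edges G" if "y \<in> set (take j ys)" for y using ys(2) in_set_takeD[OF that] by blast
    have e2: "{w, g y} \<in> edges F" if y: "y \<in> set (take j ys)" for y
    proof -
      obtain a where a: "a < j" "y = ys ! a" using J[OF y] by blast
      then have "xs ! a \<in> set xs" using xs(1) j by simp
      then show ?thesis using xs(2) a g j by simp
    qed
    obtain \<phi> where \<phi>: "attached D F G r (set (take j ys)) \<phi>" "\<phi> r = w"
      "\<And>y. y \<in> set (take j ys) \<Longrightarrow> \<phi> y = g y"
      using ex_attached[OF F(1) G(1) r w e1 e2 inj disjI1[OF farJ]] by blast
    have "\<phi> (ys ! i) = xs ! i" if i: "i < j" for i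
    proof -
      have "ys ! i \<in> set (take j ys)" using i j by (auto simp: in_set_conv_nth)
      then show ?thesis using \<phi>(3) g i j by simp
    qed
    then show ?thesis using \<phi>(1,2) by blast
  qed
  have step: "\<exists>\<phi>. attached D F G r (set (take j ys)) \<phi> \<and> \<phi> r = w \<and> (\<forall>i<j. \<phi> (ys ! i) = xs ! i) \<and>
      colourable q L (graph_union F (image_graph \<phi> G))" if "j \<le> length ys" for j
    using that
  proof (induction j)
    case 0
    obtain \<phi> where \<phi>: "attached D F G r (set (take 0 ys)) \<phi>" "\<phi> r = w" using att[of 0] by blast
    obtain c d where cd: "good q L F c" "good q L G d" using F(2) G(2) unfolding colourable_def by blast
    have "c {\<phi> r, \<phi> y} = d {r, y}" if "y \<in> set (take 0 ys)" for y using that by simp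
    then obtain b where "good q L (graph_union F (image_graph \<phi> G)) b"
      using attached_good[OF \<phi>(1) L cd] by blast
    then show ?case using \<phi> unfolding colourable_def by auto
  next
    case (Suc j)
    then obtain \<phi> where \<phi>: "attached D F G r (set (take j ys)) \<phi>" "\<phi> r = w"
      "\<And>i. i < j \<Longrightarrow> \<phi> (ys ! i) = xs ! i" "colourable q L (graph_union F (image_graph \<phi> G))" by auto
    obtain \<psi> where \<psi>: "attached D F G r (set (take (Suc j) ys)) \<psi>" "\<psi> r = w"
      "\<And>i. i < Suc j \<Longrightarrow> \<psi> (ys ! i) = xs ! i" using att[OF Suc.prems] by blast
    let ?N = "graph_union F (image_graph \<phi> G)" and ?N' = "graph_union F (image_graph \<psi> G)"
    have simN: "simple_graph ?N" "simple_graph ?N'"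
      using attached_simple[OF \<phi>(1)] attached_simple[OF \<psi>(1)] by blast+
    have jl: "j < length ys" using Suc.prems by simp
    \<comment> \<open>Both gluings are made of the same pieces \<open>F\<close> and
      \<open>G\<close>. A good colouring of \<open>?N\<close> restricts to both pieces, and if the
      two edges to be merged have equal colours, the restrictions agree on the larger star and
      recombine in \<open>?N'\<close>.\<close>
    have merge: "colourable q K ?N'" if K: "triconn K" "(card (verts K))\<^sup>2 \<le> D" and c: "good q K ?N c"
      and eq: "c {w, \<phi> (ys ! j)} = c {w, xs ! j}" for K :: "'k graph" and c
    proof -
      have c1: "good q K F c" using good_subgraph[OF _ _ c] unfolding graph_union_def by simp
      have c2: "good q K G (\<lambda>e. c (\<phi> ` e))" using good_pullback[OF attached_emb[OF \<phi>(1)] c] .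
      have "c {\<psi> r, \<psi> y} = c (\<phi> ` {r, y})" if y: "y \<in> set (take (Suc j) ys)" for y
      proof -
        obtain i where i: "i < Suc j" "y = ys ! i" using y Suc.prems by (auto simp: in_set_conv_nth)
        then have "\<psi> y = xs ! i" using \<psi>(3) by simp
        moreover have "i < j \<or> i = j" using i(1) by linarith
        ultimately show ?thesis using i(2) \<phi>(2,3) \<psi>(2) eq by auto
      qed
      then obtain b where "good q K ?N' b" using attached_good[OF \<psi>(1) K c1 c2] by blast
      then show ?thesis unfolding colourable_def by blast
    qed
    have "colourable q L ?N'"
    proof (rule ccontr)
      assume nc: "\<not> colourable q L ?N'"
      then have nc': "\<not> colourable q L' ?N'" using equiv[OF simN(2)] by blast
      have V: "\<phi> ` verts G \<inter> verts F = insert w (\<phi> ` set (take j ys))"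
        using \<phi>(1,2) unfolding attached_def by simp
      have xF: "{w, xs ! j} \<in> edges F" using xs jl by simp
      have xV: "xs ! j \<in> verts F" "xs ! j \<noteq> w" using simple_edgeD[OF F(1) xF] by auto
      have im: "\<exists>i<j. \<phi> y = xs ! i" if y: "y \<in> set (take j ys)" for y
      proof -
        obtain i where "i < j" "y = ys ! i" using y jl by (auto simp: in_set_conv_nth)
        then show ?thesis using \<phi>(3) by blast
      qed
      have "xs ! j \<noteq> \<phi> y" if y: "y \<in> set (take j ys)" for y
      proof -
        obtain i where "i < j" "\<phi> y = xs ! i" using im[OF y] by blast
        then show ?thesis using xsn[of i j] jl by simp
      qed
      then have "xs ! j \<notin> \<phi> ` set (take j ys)" by blast
      then have xG: "xs ! j \<notin> \<phi> ` verts G" using V xV by blast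
      have yV: "ys ! j \<in> verts G" using simple_edgeD(3)[OF G(1) ys(2)] jl by simp
      \<comment> \<open>A walk from the copy to \<open>xs ! j\<close> last leaves the copy at some
        \<open>xs ! i\<close> with \<open>i < j\<close>, and \<open>far\<close> excludes a short
        continuation in \<open>F\<close>.\<close>
      have "far D ?N w (\<phi> (ys ! j)) (xs ! j)" unfolding far_def
      proof (intro allI impI notI)
        fix m assume m: "m \<le> D" "(\<phi> (ys ! j), xs ! j) \<in> adj_avoiding ?N w ^^ m"
        have "(\<phi> (ys ! j), xs ! j) \<in> adj_avoiding ?N (\<phi> r) ^^ m" using m(2) \<phi>(2) by simp
        then obtain y m' where y: "y \<in> set (take j ys)" "m' \<le> m" "(\<phi> y, xs ! j) \<in> adj_avoiding F w ^^ m'"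
          using attached_path[OF \<phi>(1) xV(1) xG] \<phi>(2) yV by (metis imageI)
        then obtain i where "i < j" "m' \<le> m" "(xs ! i, xs ! j) \<in> adj_avoiding F w ^^ m'"
          using im[OF y(1)] by metis
        then show False using far[of i j] jl xs(1) m(1) unfolding far_def by auto
      qed
      moreover have "{w, xs ! j} \<in> edges ?N" using xF unfolding graph_union_def by simp
      moreover have "{w, \<phi> (ys ! j)} \<in> edges ?N"
      proof -
        have "{r, ys ! j} \<in> edges G" using ys(2) jl by simp
        then have "\<phi> ` {r, ys ! j} \<in> edges ?N" using attached_emb[OF \<phi>(1)] unfolding emb_def by blast
        then show ?thesis using \<phi>(2) by simp
      qed
      ultimately have "negative_sender q D L L' ?N w (\<phi> (ys ! j)) (xs ! j)"
        unfolding negative_sender_def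
        using simN \<phi>(4) equiv[OF simN(1)] merge[OF L] merge[OF L'] nc nc' by blast
      then show False using none by blast
    qed
    then show ?case using \<psi> by blast
  qed
  show thesis using step[of "length ys"] that by auto
qed


lemma ex_negative_sender:
  fixes L :: "'a graph" and L' :: "'b graph"
  assumes L: "triconn L" "(card (verts L))\<^sup>2 \<le> D" and L': "triconn L'" "(card (verts L'))\<^sup>2 \<le> D"
    and q: "2 \<le> q"
    and equiv: "\<And>G :: nat graph. simple_graph G \<Longrightarrow> colourable q L G \<longleftrightarrow> colourable q L' G"
  shows "\<exists>N r y y'. negative_sender q D L L' N r y y'"
proof (rule ccontr)
  assume none: "\<not> ?thesis"
  have q0: "0 < q" using q by simp
  obtain G :: "nat graph" and r where G: "simple_graph G" "r \<in> verts G" "colourable q L G"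
    "\<And>c i. good q L G c \<Longrightarrow> i < q \<Longrightarrow> \<exists>y. {r, y} \<in> edges G \<and> c {r, y} = i"
    using ex_full_star[OF L(1) q0] by blast
  have "finite {y. {r, y} \<in> edges G}"
  proof (rule finite_subset)
    show "{y. {r, y} \<in> edges G} \<subseteq> verts G" using simple_edgeD(3)[OF G(1)] by blast
    show "finite (verts G)" using G(1) unfolding simple_graph_def by blast
  qed
  then obtain ys where ys: "distinct ys" "set ys = {y. {r, y} \<in> edges G}" using finite_distinct_list by blast
  define k where "k = length ys"
  obtain c0 where c0: "good q L G c0" using G(3) unfolding colourable_def by blast
  have "ys \<noteq> []" using G(4)[OF c0, of 0] q ys(2) by auto
  then have k: "1 \<le> k" unfolding k_def by (cases ys) auto
  obtain n hs0 where hs0: "sparse D hs0" "\<And>xs. xs \<in> set hs0 \<Longrightarrow> length xs = k \<and> set xs \<subseteq> {..<n}"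
    "\<And>S. \<exists>xs\<in>set hs0. mono_on_edge S xs"
    using ex_sparse_hypergraph[OF k, of D] by auto
  \<comment> \<open>The centre is the vertex \<open>n\<close>, and the hypergraph vertices below
    \<open>n\<close> are the leaves of a star. The set \<open>\<alpha> u\<close> is the shadow of
    \<open>u\<close> in the hypergraph: edges away from the centre have both shadows inside one
    hyperedge, so walks in \<open>F - n\<close> project to walks of the same length along
    \<open>hyper_adj hs\<close>. This turns sparseness into distance in \<open>F\<close>.\<close>
  define inv where "inv hs F \<alpha> \<longleftrightarrow> simple_graph F \<and> n \<in> verts F \<and> (\<forall>x<n. {n, x} \<in> edges F) \<and>
      colourable q L F \<and> (\<forall>xs\<in>set hs. \<exists>\<phi>. emb \<phi> G F \<and> \<phi> r = n \<and> (\<forall>i<k. \<phi> (ys ! i) = xs ! i)) \<and>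
      (\<forall>x<n. \<alpha> x = {x}) \<and> (\<forall>u\<in>verts F. \<alpha> u \<noteq> {}) \<and>
      (\<forall>u v. {u, v} \<in> edges F \<and> u \<noteq> n \<and> v \<noteq> n \<longrightarrow> (\<exists>zs\<in>set hs. \<alpha> u \<union> \<alpha> v \<subseteq> set zs))"
    for hs F and \<alpha> :: "nat \<Rightarrow> nat set"
  have "\<exists>F \<alpha>. inv hs F \<alpha>"
    if "sparse D hs" "\<And>xs. xs \<in> set hs \<Longrightarrow> length xs = k \<and> set xs \<subseteq> {..<n}" for hs
    using that
  proof (induction hs)
    case Nil
    define F where "F = ({..n}, (\<lambda>x. {n, x}) ` {..<n})"
    have F: "simple_graph F" 
    proof (rule simple_graphI)
      fix e assume "e \<in> edges F"
      then obtain x where "x < n" "e = {n, x}" unfolding F_def by auto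
      then show "\<exists>u v. e = {u, v} \<and> u \<noteq> v \<and> u \<in> verts F \<and> v \<in> verts F"
        by (intro exI[of _ n] exI[of _ x]) (simp add: F_def)
    qed (simp add: F_def)
    have "good q L F (\<lambda>_. 0)"
    proof -
      have False if \<phi>: "emb \<phi> L F" for \<phi>
      proof -
        have "p \<notin> \<phi> ` verts L" if "p \<noteq> n" for p
          using that by (intro pendant_not_in_emb[OF L(1) \<phi>, of p n]) (auto simp: F_def)
        then have "\<phi> ` verts L \<subseteq> {n}" by blast
        then have "card (\<phi> ` verts L) \<le> 1" using card_mono[of "{n}"] by fastforce
        moreover have "card (\<phi> ` verts L) = card (verts L)" using \<phi> unfolding emb_def by (simp add: card_image)
        ultimately show False using L(1) unfolding triconn_def by simp
      qed
      then show ?thesis using q unfolding good_def by auto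
    qed
    then have "colourable q L F" unfolding colourable_def by blast
    moreover have "n \<in> verts F" "\<forall>x<n. {n, x} \<in> edges F" unfolding F_def by auto
    moreover have "u = n \<or> v = n" if "{u, v} \<in> edges F" for u v
      using that unfolding F_def by (auto simp: doubleton_eq_iff)
    ultimately have "inv [] F (\<lambda>x. {x})" unfolding inv_def using F by auto
    then show ?case by blast
  next
    case (Cons xs hs)
    have "sparse D hs" "\<And>zs. zs \<in> set hs \<Longrightarrow> length zs = k \<and> set zs \<subseteq> {..<n}"
      using Cons.prems by auto
    then obtain F \<alpha> where inv: "inv hs F \<alpha>" using Cons.IH by blast
    have F: "simple_graph F" "n \<in> verts F"
      "\<And>x. x < n \<Longrightarrow> {n, x} \<in> edges F" "colourable q L F"
      and embs: "\<And>zs. zs \<in> set hs \<Longrightarrow> \<exists>\<phi>. emb \<phi> G F \<and> \<phi> r = n \<and> (\<forall>i<k. \<phi> (ys ! i) = zs ! i)"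
      and \<alpha>: "\<And>x. x < n \<Longrightarrow> \<alpha> x = {x}" "\<And>u. u \<in> verts F \<Longrightarrow> \<alpha> u \<noteq> {}"
      "\<And>u v. {u, v} \<in> edges F \<Longrightarrow> u \<noteq> n \<Longrightarrow> v \<noteq> n \<Longrightarrow> \<exists>zs\<in>set hs. \<alpha> u \<union> \<alpha> v \<subseteq> set zs"
      using inv unfolding inv_def by blast+
    have xs: "length xs = length ys" "set xs \<subseteq> {..<n}" using Cons.prems(2)[of xs] k_def by auto
    have path: "(x, x') \<in> hyper_adj hs ^^ m"
      if "(x, u) \<in> adj_avoiding F n ^^ m" "x < n" "x' \<in> \<alpha> u" for x u x' m
      using that
    proof (induction m arbitrary: u x')
      case 0
      then show ?case using \<alpha>(1) by simp
    next
      case (Suc m)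
      then obtain v where v: "(x, v) \<in> adj_avoiding F n ^^ m" "(v, u) \<in> adj_avoiding F n" by auto
      then have vu: "{v, u} \<in> edges F" "v \<noteq> n" "u \<noteq> n" unfolding adj_avoiding_def by auto
      obtain zs where zs: "zs \<in> set hs" "\<alpha> v \<union> \<alpha> u \<subseteq> set zs" using \<alpha>(3)[OF vu] by blast
      obtain z where z: "z \<in> \<alpha> v" using \<alpha>(2) simple_edgeD(2)[OF F(1) vu(1)] by blast
      have "(z, x') \<in> hyper_adj hs" using zs z Suc.prems(3) unfolding hyper_adj_def by blast
      then show ?case using Suc.IH[OF v(1) Suc.prems(2) z] by auto
    qed
    have far: "far D F n (xs ! i) (xs ! j)" if ij: "i < length xs" "j < length xs" "i \<noteq> j" for i j
    proof -
      have lt: "xs ! i < n" "xs ! j < n" using xs(2) ij nth_mem by blast+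
      have "hyper_far D hs (xs ! i) (xs ! j)" using sparse_hyper_far[OF Cons.prems(1) ij] .
      then show ?thesis using path[of "xs ! i" "xs ! j" _ "xs ! j"] lt \<alpha>(1)[OF lt(2)]
        unfolding far_def hyper_far_def by blast
    qed
    have ysE: "{r, y} \<in> edges G" if "y \<in> set ys" for y using that ys(2) by blast
    have xsE: "{n, x} \<in> edges F" if "x \<in> set xs" for x using that xs(2) F(3) by blast
    obtain \<phi> where \<phi>: "attached D F G r (set ys) \<phi>" "\<phi> r = n" "\<And>i. i < length ys \<Longrightarrow> \<phi> (ys ! i) = xs ! i"
      "colourable q L (graph_union F (image_graph \<phi> G))"
      using attach_or_sender[OF L L' equiv none F(1,4) G(1,3,2) F(2) ys(1) ysE xs(1) xsE far] by blast
    let ?U = "graph_union F (image_graph \<phi> G)"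
    \<comment> \<open>Every new vertex of the attached copy casts the whole hyperedge
      \<open>xs\<close> as its shadow.\<close>
    define \<beta> where "\<beta> u = (if u \<in> verts F then \<alpha> u else set xs)" for u
    have simU: "simple_graph ?U" by (rule attached_simple[OF \<phi>(1)])
    have sub: "verts F \<subseteq> verts ?U" "edges F \<subseteq> edges ?U" unfolding graph_union_def by auto
    have V: "\<phi> ` verts G \<inter> verts F = insert n (\<phi> ` set ys)" using \<phi>(1,2) unfolding attached_def by simp
    have ysxs: "\<phi> ` set ys \<subseteq> set xs"
    proof (rule image_subsetI)
      fix y assume "y \<in> set ys"
      then obtain i where "i < length ys" "y = ys ! i" by (auto simp: in_set_conv_nth)
      then show "\<phi> y \<in> set xs" using \<phi>(3) xs(1) by simp
    qed
    have \<beta>G: "\<beta> u \<subseteq> set xs" if u: "u \<in> \<phi> ` verts G" "u \<noteq> n" for u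
    proof (cases "u \<in> verts F")
      case True
      then have "u \<in> set xs" using V ysxs u by blast
      then have "u < n" using xs(2) by blast
      then show ?thesis using \<alpha>(1) True \<open>u \<in> set xs\<close> unfolding \<beta>_def by simp
    qed (simp add: \<beta>_def)
    have imV: "a \<in> \<phi> ` verts G \<and> b \<in> \<phi> ` verts G" if "{a, b} \<in> edges (image_graph \<phi> G)" for a b
    proof -
      have "simple_graph (image_graph \<phi> G)" using \<phi>(1) image_graph_simple unfolding attached_def by blast
      then show ?thesis using simple_edgeD[OF _ that] unfolding image_graph_def by simp
    qed
    have edges: "\<exists>zs\<in>set (xs # hs). \<beta> u \<union> \<beta> v \<subseteq> set zs" if e: "{u, v} \<in> edges ?U" "u \<noteq> n" "v \<noteq> n" for u v
    proof (cases "{u, v} \<in> edges F")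
      case True
      then have "u \<in> verts F" "v \<in> verts F" using simple_edgeD[OF F(1)] by auto
      then show ?thesis using \<alpha>(3)[OF True e(2,3)] unfolding \<beta>_def by simp
    next
      case False
      then have "{u, v} \<in> edges (image_graph \<phi> G)" using e(1) unfolding graph_union_def by simp
      then have "\<beta> u \<union> \<beta> v \<subseteq> set xs" using imV \<beta>G e(2,3) by blast
      then show ?thesis by simp
    qed
    have embs': "\<exists>\<psi>. emb \<psi> G ?U \<and> \<psi> r = n \<and> (\<forall>i<k. \<psi> (ys ! i) = zs ! i)" if zs: "zs \<in> set (xs # hs)" for zs
    proof (cases "zs = xs")
      case True
      then show ?thesis using attached_emb[OF \<phi>(1)] \<phi>(2,3) k_def by blast
    next
      case False
      then have "zs \<in> set hs" using zs by simp
      then obtain \<psi> where "emb \<psi> G F" "\<psi> r = n \<and> (\<forall>i<k. \<psi> (ys ! i) = zs ! i)" using embs by blast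
      then show ?thesis using emb_mono[OF _ sub] by blast
    qed
    have single: "\<beta> x = {x}" if "x < n" for x
      using \<alpha>(1)[OF that] simple_edgeD(3)[OF F(1) F(3)[OF that]] unfolding \<beta>_def by simp
    have nonempty: "\<beta> u \<noteq> {}" if "u \<in> verts ?U" for u
    proof -
      have "xs \<noteq> []" using xs(1) \<open>ys \<noteq> []\<close> by auto
      then show ?thesis using \<alpha>(2) unfolding \<beta>_def by simp
    qed
    have "inv (xs # hs) ?U \<beta>" unfolding inv_def
    proof (intro conjI)
      show "n \<in> verts ?U" "\<forall>x<n. {n, x} \<in> edges ?U" using sub F(2,3) by blast+
      show "\<forall>u v. {u, v} \<in> edges ?U \<and> u \<noteq> n \<and> v \<noteq> n \<longrightarrow> (\<exists>zs\<in>set (xs # hs). \<beta> u \<union> \<beta> v \<subseteq> set zs)"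
        using edges by blast
      show "simple_graph ?U" "colourable q L ?U" by (fact simU, fact \<phi>(4))
      show "\<forall>zs\<in>set (xs # hs). \<exists>\<psi>. emb \<psi> G ?U \<and> \<psi> r = n \<and> (\<forall>i<k. \<psi> (ys ! i) = zs ! i)"
        by (rule ballI) (rule embs')
      show "\<forall>x<n. \<beta> x = {x}" by (intro allI impI) (rule single)
      show "\<forall>u\<in>verts ?U. \<beta> u \<noteq> {}" by (rule ballI) (rule nonempty)
    qed
    then show ?case by blast
  qed
  then obtain F \<alpha> where "inv hs0 F \<alpha>" using hs0(1,2) by blast
  then have F: "simple_graph F" "colourable q L F"
    "\<And>xs. xs \<in> set hs0 \<Longrightarrow> \<exists>\<phi>. emb \<phi> G F \<and> \<phi> r = n \<and> (\<forall>i<k. \<phi> (ys ! i) = xs ! i)"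
    unfolding inv_def by blast+
  obtain c where c: "good q L F c" using F(2) unfolding colourable_def by blast
  obtain xs where xs: "xs \<in> set hs0" "mono_on_edge {x. c {n, x} = 0} xs" using hs0(3) by blast
  obtain \<phi> where \<phi>: "emb \<phi> G F" "\<phi> r = n" "\<And>i. i < k \<Longrightarrow> \<phi> (ys ! i) = xs ! i" using F(3)[OF xs(1)] by blast
  have col: "\<exists>x\<in>set xs. c {n, x} = i" if i: "i < q" for i
  proof -
    obtain y where y: "{r, y} \<in> edges G" "c (\<phi> ` {r, y}) = i"
      using G(4)[OF good_pullback[OF \<phi>(1) c] i] by blast
    then obtain j where j: "j < k" "y = ys ! j" using ys(2) k_def by (metis in_set_conv_nth mem_Collect_eq)
    then have "xs ! j \<in> set xs" using hs0(2)[OF xs(1)] by simp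
    then show ?thesis using y(2) j \<phi>(2,3) by auto
  qed
  obtain x x' where "x \<in> set xs" "c {n, x} = 0" "x' \<in> set xs" "c {n, x'} = 1" using col[of 0] col[of 1] q by auto
  then show False using xs(2) unfolding mono_on_edge_def by auto
qed

section \<open>Enforcing unequal colours with senders\<close>

lemma ex_bij_two:
  fixes s t s' t' q :: nat
  assumes "s < q" "t < q" "s' < q" "t' < q" "s \<noteq> t" "s' \<noteq> t'"
  obtains \<pi> where "bij_betw \<pi> {..<q} {..<q}" "\<pi> s = s'" "\<pi> t = t'"
proof -
  define sw where "sw a b = id(a := b, b := a)" for a b :: nat
  have sw: "bij_betw (sw a b) {..<q} {..<q}" if "a < q" "b < q" for a b
    by (rule bij_betw_byWitness[where f' = "sw a b"]) (use that in \<open>auto simp: sw_def\<close>)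
  \<comment> \<open>After the swap of \<open>s\<close> and \<open>s'\<close>, the value
    \<open>t\<close> sits at \<open>u\<close>. A second swap moves it to \<open>t'\<close> and fixes
    \<open>s'\<close>, which differs from both \<open>u\<close> and \<open>t'\<close>.\<close>
  define u where "u = sw s s' t"
  have u: "u < q" "u \<noteq> s'" using assms unfolding u_def sw_def by auto
  have "bij_betw (sw u t' \<circ> sw s s') {..<q} {..<q}"
    using bij_betw_trans[OF sw[OF assms(1,3)] sw[OF u(1) assms(4)]] .
  moreover have "(sw u t' \<circ> sw s s') s = s'" using u(2) assms(6) unfolding sw_def by auto
  moreover have "(sw u t' \<circ> sw s s') t = t'" unfolding u_def[symmetric] comp_def by (simp add: sw_def)
  ultimately show thesis using that by blast
qed

text \<open>One sender per triple is placed with its centre at \<open>v\<close> and its terminals at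
  \<open>a\<close> and \<open>b\<close>. Every good colouring for \<open>L\<close> must then
  separate the two edges, while \<open>c\<close>, which already separates them, extends to a good
  colouring for \<open>L'\<close>.\<close>

lemma attach_senders:
  fixes L :: "'a graph" and L' :: "'b graph" and F :: "nat graph" and ts :: "(nat \<times> nat \<times> nat) list"
  assumes N: "negative_sender q D L L' N r y y'"
    and L': "triconn L'" "(card (verts L'))\<^sup>2 \<le> D"
    and F: "simple_graph F" "good q L' F c"
    and ts: "\<And>v a b. (v, a, b) \<in> set ts \<Longrightarrow>
      {v, a} \<in> edges F \<and> {v, b} \<in> edges F \<and> a \<noteq> b \<and> c {v, a} \<noteq> c {v, b}"
  shows "\<exists>F' c'. simple_graph F' \<and> verts F \<subseteq> verts F' \<and> edges F \<subseteq> edges F' \<and> good q L' F' c' \<and>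
    (\<forall>d. good q L F' d \<longrightarrow> (\<forall>(v, a, b)\<in>set ts. d {v, a} \<noteq> d {v, b}))"
  using F ts
proof (induction ts arbitrary: F c)
  case Nil
  then show ?case by (intro exI[of _ F] exI[of _ c]) simp
next
  case (Cons t ts)
  obtain v a b where t: "t = (v, a, b)" by (cases t)
  have vab: "{v, a} \<in> edges F" "{v, b} \<in> edges F" "a \<noteq> b" "c {v, a} \<noteq> c {v, b}"
    using Cons.prems(3)[of v a b] t by auto
  have simN: "simple_graph N" and ry: "{r, y} \<in> edges N" "{r, y'} \<in> edges N" and far: "far D N r y y'"
    and neg: "\<And>c. good q L N c \<Longrightarrow> c {r, y} \<noteq> c {r, y'}"
    using N unfolding negative_sender_def by auto
  obtain c0 where c0: "good q L' N c0" "c0 {r, y} \<noteq> c0 {r, y'}"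
    using N unfolding negative_sender_def colourable_def by blast
  have yy: "y \<noteq> y'" using far by (rule far_neq)
  have lt: "c0 {r, y} < q" "c0 {r, y'} < q" "c {v, a} < q" "c {v, b} < q"
    using c0(1) ry Cons.prems(2) vab(1,2) unfolding good_def by auto
  \<comment> \<open>A permutation of the colours makes the sender's colouring match \<open>c\<close>
    on both shared edges.\<close>
  obtain \<pi> where \<pi>: "bij_betw \<pi> {..<q} {..<q}" "\<pi> (c0 {r, y}) = c {v, a}" "\<pi> (c0 {r, y'}) = c {v, b}"
    by (rule ex_bij_two[OF lt c0(2) vab(4)])
  have c1: "good q L' N (\<pi> \<circ> c0)" by (rule good_recolour[OF c0(1) \<pi>(1)])
  define g where "g x = (if x = y then a else b)" for x
  have e1: "{r, x} \<in> edges N" if "x \<in> {y, y'}" for x using that ry by auto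
  have e2: "{v, g x} \<in> edges F" if "x \<in> {y, y'}" for x using vab unfolding g_def by auto
  have inj: "inj_on g {y, y'}" using vab(3) yy unfolding g_def by (auto simp: inj_on_def)
  \<comment> \<open>The distance is supplied by the sender, so \<open>a\<close> and \<open>b\<close>
    may be arbitrarily close in \<open>F\<close>.\<close>
  have farJ: "\<forall>x\<in>{y, y'}. \<forall>z\<in>{y, y'}. x \<noteq> z \<longrightarrow> far D N r x z" using far far_sym[OF far] by blast
  have rN: "r \<in> verts N" and vF: "v \<in> verts F"
    using simple_edgeD[OF simN ry(1)] simple_edgeD[OF Cons.prems(1) vab(1)] by auto
  obtain \<phi> where \<phi>: "attached D F N r {y, y'} \<phi>" "\<phi> r = v" "\<And>x. x \<in> {y, y'} \<Longrightarrow> \<phi> x = g x"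
    using ex_attached[OF Cons.prems(1) simN rN vF e1 e2 inj disjI2[OF farJ]] by blast
  have \<phi>y: "\<phi> y = a" "\<phi> y' = b" using \<phi>(3) yy unfolding g_def by auto
  let ?U = "graph_union F (image_graph \<phi> N)"
  have eq: "c {\<phi> r, \<phi> x} = (\<pi> \<circ> c0) {r, x}" if "x \<in> {y, y'}" for x using that \<phi>(2) \<phi>y \<pi>(2,3) by auto
  obtain c2 where c2: "good q L' ?U c2" "\<And>e. e \<in> edges F \<Longrightarrow> c2 e = c e"
    using attached_good[OF \<phi>(1) L' Cons.prems(2) c1 eq] by blast
  have sub: "verts F \<subseteq> verts ?U" "edges F \<subseteq> edges ?U" unfolding graph_union_def by auto
  have rest: "{v, a} \<in> edges ?U \<and> {v, b} \<in> edges ?U \<and> a \<noteq> b \<and> c2 {v, a} \<noteq> c2 {v, b}"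
    if "(v, a, b) \<in> set ts" for v a b
    using Cons.prems(3)[of v a b] that sub(2) c2(2) by auto
  obtain F' c' where F': "simple_graph F'" "verts ?U \<subseteq> verts F'" "edges ?U \<subseteq> edges F'" "good q L' F' c'"
    "\<forall>d. good q L F' d \<longrightarrow> (\<forall>(v, a, b)\<in>set ts. d {v, a} \<noteq> d {v, b})"
    using Cons.IH[OF attached_simple[OF \<phi>(1)] c2(1) rest] by blast
  have "d {v, a} \<noteq> d {v, b}" if d: "good q L F' d" for d
  proof -
    have "emb \<phi> N F'" by (rule emb_mono[OF attached_emb[OF \<phi>(1)] F'(2,3)])
    then have "d (\<phi> ` {r, y}) \<noteq> d (\<phi> ` {r, y'})" using neg[OF good_pullback[OF _ d]] by blast
    then show ?thesis using \<phi>(2) \<phi>y by simp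
  qed
  then show ?case
    using F' sub t by (intro exI[of _ F'] exI[of _ c']) auto
qed

section \<open>Separating two graphs\<close>


lemma triconn_connected:
  assumes L: "triconn L" and uv: "u \<in> verts L" "v \<in> verts L"
  shows "(u, v) \<in> {(x, y). {x, y} \<in> edges L}\<^sup>*"
proof -
  have "connected_graph (delete_verts L {})" using L unfolding triconn_def by simp
  moreover have "delete_verts L {} = L" unfolding delete_verts_def by simp
  ultimately show ?thesis using uv unfolding connected_graph_def by simp
qed

text \<open>The common colour at a vertex is also the colour of an edge at each neighbour, so it
  spreads along walks.\<close>

lemma connected_constant:
  assumes L: "triconn L"
    and c: "\<And>v u u'. {v, u} \<in> edges L \<Longrightarrow> {v, u'} \<in> edges L \<Longrightarrow> c {v, u} = c {v, u'}"
  obtains i where "\<And>e. e \<in> edges L \<Longrightarrow> c e = i"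
proof -
  have sim: "simple_graph L" using L by (rule triconn_simple)
  have "verts L \<noteq> {}" using L unfolding triconn_def by auto
  then obtain a where a: "a \<in> verts L" by blast
  obtain b where b: "{a, b} \<in> edges L" by (rule triconn_neighbour[OF L a])
  have star: "\<forall>u. {v, u} \<in> edges L \<longrightarrow> c {v, u} = c {a, b}" if v: "v \<in> verts L" for v
    using triconn_connected[OF L a v]
  proof induction
    case base
    then show ?case using c b by blast
  next
    case (step v z)
    then have e: "{z, v} \<in> edges L" "c {z, v} = c {a, b}" by (auto simp: insert_commute)
    then show ?case using c[OF e(1)] by metis
  qed
  show thesis
  proof (rule that)
    fix e assume e: "e \<in> edges L"
    obtain u v where "e = {u, v}" "u \<in> verts L" by (rule simple_edgeE[OF sim e])
    then show "c e = c {a, b}" using star e by blast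
  qed
qed

text \<open>
  With \<open>q - 1\<close> pendant edges of distinct colours at each vertex \<open>v\<close>, the edges of \<open>L\<close> at \<open>v\<close>
  are forced to take the one remaining colour.
\<close>
lemma ex_distinguishing_graph:
  fixes L :: "'a graph" and L' :: "'b graph"
  assumes L: "triconn L" and L': "triconn L'" and q: "2 \<le> q" and no: "\<nexists>\<phi>. emb \<phi> L' L"
  shows "\<exists>G :: nat graph. simple_graph G \<and> colourable q L G \<noteq> colourable q L' G"
proof (rule ccontr)
  assume "\<not> ?thesis"
  then have equiv: "colourable q L G \<longleftrightarrow> colourable q L' G" if "simple_graph G" for G :: "nat graph"
    using that by blast
  define D where "D = (card (verts L))\<^sup>2 + (card (verts L'))\<^sup>2"
  have D: "(card (verts L))\<^sup>2 \<le> D" "(card (verts L'))\<^sup>2 \<le> D" unfolding D_def by auto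
  obtain N r y y' where N: "negative_sender q D L L' N r y y'"
    using ex_negative_sender[OF L D(1) L' D(2) q equiv] by blast
  have sim: "simple_graph L" using L by (rule triconn_simple)
  obtain K :: "nat graph" and f h where K: "simple_graph K" "emb f L K" "emb h K L"
    by (rule ex_nat_copy[OF sim])
  have finK: "finite (verts K)" using K(1) unfolding simple_graph_def by blast
  \<comment> \<open>Pendant vertices are numbered from \<open>B\<close> on, above all vertices of
    \<open>K\<close>, and the pairing function keeps them distinct.\<close>
  define B where "B = Suc (Max (verts K))"
  define p where "p v i = B + prod_encode (v, i)" for v i
  have Bgt: "v < B" if "v \<in> verts K" for v using Max_ge[OF finK that] unfolding B_def by simp
  have p_inj: "p v i = p v' i' \<longleftrightarrow> v = v' \<and> i = i'" for v i v' i' unfolding p_def by simp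
  have p_ge: "B \<le> p v i" for v i unfolding p_def by simp
  have pK: "p v i \<notin> verts K" for v i using Bgt p_ge by (meson leD)
  \<comment> \<open>These \<open>q - 1\<close> values index the pendant edges at each vertex and are
    their colours under \<open>c\<close>. Colour 0 is left for \<open>K\<close>.\<close>
  define I where "I = {1..<q}"
  define F where "F = (verts K \<union> (\<lambda>(v, i). p v i) ` (verts K \<times> I),
    edges K \<union> (\<lambda>(v, i). {v, p v i}) ` (verts K \<times> I))"
  have VF: "verts F = verts K \<union> (\<lambda>(v, i). p v i) ` (verts K \<times> I)"
    and EF: "edges F = edges K \<union> (\<lambda>(v, i). {v, p v i}) ` (verts K \<times> I)" unfolding F_def by auto
  have simF: "simple_graph F"
  proof (rule simple_graphI)
    show "finite (verts F)" unfolding VF I_def using finK by simp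
    fix e assume "e \<in> edges F"
    then consider "e \<in> edges K" | v i where "e = {v, p v i}" "v \<in> verts K" "i \<in> I" unfolding EF by auto
    then show "\<exists>u v. e = {u, v} \<and> u \<noteq> v \<and> u \<in> verts F \<and> v \<in> verts F"
    proof cases
      case 1
      obtain u v where "e = {u, v}" "u \<noteq> v" "u \<in> verts K" "v \<in> verts K" by (rule simple_edgeE[OF K(1) 1])
      then show ?thesis unfolding VF by blast
    next
      case 2
      then have "v \<noteq> p v i" using pK by metis
      then show ?thesis using 2 unfolding VF by blast
    qed
  qed
  \<comment> \<open>On a pendant edge, \<open>Max e\<close> is the vertex \<open>p v i\<close>, from which \<open>c\<close> recovers the colour \<open>i\<close>.\<close>
  define c where "c e = (if e \<subseteq> verts K then 0 else snd (prod_decode (Max e - B)))" for e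
  have cK: "c e = 0" if "e \<in> edges K" for e using simple_edge_subset[OF K(1) that] unfolding c_def by simp
  have cp: "c {v, p v i} = i" if "v \<in> verts K" for v i
  proof -
    have "v \<le> p v i" using Bgt[OF that] p_ge[of v i] by linarith
    then have "Max {v, p v i} = p v i" by (simp add: max_def)
    then show ?thesis using pK[of v i] unfolding c_def p_def by simp
  qed
  \<comment> \<open>\<open>F\<close> contains no copy of \<open>L'\<close> at all: a pendant vertex
    cannot lie in one, and a copy inside \<open>K\<close> would embed \<open>L'\<close> into
    \<open>L\<close>.\<close>
  have good: "good q L' F c"
  proof -
    have "c ` edges F \<subseteq> {..<q}" using cK cp q unfolding EF I_def by auto
    moreover have False if \<phi>: "emb \<phi> L' F" for \<phi>
    proof -
      have pend: "p v i \<notin> \<phi> ` verts L'" if vi: "v \<in> verts K" "i \<in> I" for v i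
      proof (rule pendant_not_in_emb[OF L' \<phi>])
        fix e assume e: "e \<in> edges F" "p v i \<in> e"
        have "e \<notin> edges K" using e(2) pK simple_edge_subset[OF K(1)] by blast
        then have "e \<in> (\<lambda>(v, i). {v, p v i}) ` (verts K \<times> I)" using e(1) unfolding EF by blast
        then obtain v' i' where vi': "e = {v', p v' i'}" "v' \<in> verts K" by auto
        have "p v i \<noteq> v'" using pK vi'(2) by metis
        then have "p v i = p v' i'" using e(2) vi'(1) by simp
        then show "e = {p v i, v}" using vi'(1) p_inj by (simp add: insert_commute)
      qed
      have V: "\<phi> ` verts L' \<subseteq> verts K"
      proof
        fix x assume x: "x \<in> \<phi> ` verts L'"
        then have "x \<in> verts F" using \<phi> unfolding emb_def by blast
        then consider "x \<in> verts K" | v i where "x = p v i" "v \<in> verts K" "i \<in> I" unfolding VF by auto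
        then show "x \<in> verts K"
        proof cases
          case 2
          then show ?thesis using x pend[OF 2(2,3)] by simp
        qed
      qed
      have "\<phi> ` e \<in> edges K" if e: "e \<in> edges L'" for e
      proof -
        have "\<phi> ` e \<subseteq> verts K" using V simple_edge_subset[OF triconn_simple[OF L'] e] by blast
        moreover have "\<phi> ` e \<in> edges F" using \<phi> e unfolding emb_def by blast
        ultimately show ?thesis using pK unfolding EF by auto
      qed
      then have "emb \<phi> L' K" using V \<phi> unfolding emb_def by blast
      then show False using emb_comp[OF _ K(3)] no by blast
    qed
    ultimately show ?thesis unfolding good_def by blast
  qed
  have eF: "{v, p v i} \<in> edges F" if "v \<in> verts K" "i \<in> I" for v i using that unfolding EF by auto
  \<comment> \<open>\<open>T1\<close> pairs each edge of \<open>K\<close> with the pendant edges at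
    its ends, and \<open>T2\<close> pairs the pendant edges at a common vertex. The colouring
    \<open>c\<close> separates all these pairs.\<close>
  define T1 where "T1 = (\<lambda>((v, u), i). (v, u, p v i)) ` ({(v, u). {v, u} \<in> edges K} \<times> I)"
  define T2 where "T2 = (\<lambda>(v, i, j). (v, p v i, p v j)) ` (verts K \<times> {(i, j). i \<in> I \<and> j \<in> I \<and> i \<noteq> j})"
  have "{(v, u). {v, u} \<in> edges K} \<subseteq> verts K \<times> verts K" using simple_edgeD[OF K(1)] by auto
  then have "finite {(v, u). {v, u} \<in> edges K}" using finK by (meson finite_SigmaI finite_subset)
  then have "finite T1" unfolding T1_def I_def by simp
  moreover have "finite T2"
  proof -
    have "finite {(i, j). i \<in> I \<and> j \<in> I \<and> i \<noteq> j}"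
      by (rule finite_subset[of _ "I \<times> I"]) (auto simp: I_def)
    then show ?thesis unfolding T2_def using finK by simp
  qed
  ultimately have "\<exists>ts. set ts = T1 \<union> T2" by (intro finite_list) simp
  then obtain ts where ts: "set ts = T1 \<union> T2" by (rule exE)
  have "{v, a} \<in> edges F \<and> {v, b} \<in> edges F \<and> a \<noteq> b \<and> c {v, a} \<noteq> c {v, b}" if vab: "(v, a, b) \<in> set ts" for v a b
  proof -
    consider i where "b = p v i" "{v, a} \<in> edges K" "i \<in> I"
      | i j where "a = p v i" "b = p v j" "v \<in> verts K" "i \<in> I" "j \<in> I" "i \<noteq> j"
      using vab unfolding ts T1_def T2_def by auto
    then show ?thesis
    proof cases
      case 1
      have V: "v \<in> verts K" "a \<in> verts K" using simple_edgeD[OF K(1) 1(2)] by auto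
      have "i \<noteq> 0" using 1(3) unfolding I_def by simp
      moreover have "a \<noteq> p v i" using pK V(2) by metis
      ultimately show ?thesis using 1 V eF cK[OF 1(2)] cp[OF V(1)] unfolding EF by auto
    next
      case 2
      then show ?thesis using eF cp p_inj by simp
    qed
  qed
  then obtain F' c' where F': "simple_graph F'" "verts F \<subseteq> verts F'" "edges F \<subseteq> edges F'" "good q L' F' c'"
    "\<And>d v a b. good q L F' d \<Longrightarrow> (v, a, b) \<in> set ts \<Longrightarrow> d {v, a} \<noteq> d {v, b}"
    using attach_senders[OF N L' D(2) simF good, of ts] by blast
  \<comment> \<open>Senders keep \<open>F'\<close> colourable for \<open>L'\<close>. By the assumed
    equivalence it is colourable for \<open>L\<close> too, although \<open>d\<close> will have to be
    constant on the copy of \<open>L\<close>.\<close>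
  obtain d where d: "good q L F' d"
    using F'(4) equiv[OF F'(1)] unfolding colourable_def by blast
  have dK: "d e < q" if "e \<in> edges F" for e using d F'(3) that unfolding good_def by blast
  have same: "d {v, u} = d {v, u'}" if e: "{v, u} \<in> edges K" "{v, u'} \<in> edges K" for v u u'
  proof (rule ccontr)
    assume ne: "d {v, u} \<noteq> d {v, u'}"
    have v: "v \<in> verts K" using simple_edgeD[OF K(1) e(1)] by blast
    let ?P = "(\<lambda>i. d {v, p v i}) ` I"
    have inj: "inj_on (\<lambda>i. d {v, p v i}) I"
    proof (rule inj_onI, rule ccontr)
      fix i j assume ij: "i \<in> I" "j \<in> I" "d {v, p v i} = d {v, p v j}" "i \<noteq> j"
      then have "(v, p v i, p v j) \<in> T2" using v unfolding T2_def by force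
      then show False using F'(5)[OF d, of v "p v i" "p v j"] ts ij(3) by simp
    qed
    have out: "d {v, a} \<notin> ?P" if "{v, a} \<in> edges K" for a
    proof
      assume "d {v, a} \<in> ?P"
      then obtain i where i: "i \<in> I" "d {v, a} = d {v, p v i}" by blast
      then have "(v, a, p v i) \<in> T1" using that unfolding T1_def by force
      then show False using F'(5)[OF d, of v a "p v i"] ts i(2) by simp
    qed
    \<comment> \<open>The \<open>q - 1\<close> distinct pendant colours at \<open>v\<close>,
      together with two different colours on edges of \<open>K\<close>, would make
      \<open>q + 1\<close> colours.\<close>
    let ?Q = "insert (d {v, u}) (insert (d {v, u'}) ?P)"
    have finI: "finite I" unfolding I_def by simp
    have "?Q \<subseteq> {..<q}" using dK eF v e unfolding EF by auto
    then have "card ?Q \<le> q" using card_mono[of "{..<q}" ?Q] by simp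
    moreover have "card ?Q = Suc (Suc (card ?P))" using ne out[OF e(1)] out[OF e(2)] finI by simp
    moreover have "card ?P = q - 1" using card_image[OF inj] unfolding I_def by simp
    ultimately show False using q by linarith
  qed
  have fe: "{f v, f u} \<in> edges K" if "{v, u} \<in> edges L" for v u
  proof -
    have "f ` {v, u} \<in> edges K" using K(2) that unfolding emb_def by blast
    then show ?thesis by simp
  qed
  have "d (f ` {v, u}) = d (f ` {v, u'})" if "{v, u} \<in> edges L" "{v, u'} \<in> edges L" for v u u'
    using same[OF fe[OF that(1)] fe[OF that(2)]] by simp
  then obtain i where i: "\<And>e. e \<in> edges L \<Longrightarrow> d (f ` e) = i"
    using connected_constant[OF L, of "\<lambda>e. d (f ` e)"] by blast
  have fF': "emb f L F'" using emb_mono[OF K(2), of F'] F'(2,3) unfolding VF EF by blast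
  have "verts L \<noteq> {}" using L unfolding triconn_def by auto
  then obtain a b where ab: "{a, b} \<in> edges L" using triconn_neighbour[OF L] by blast
  have "i < q" using dK[of "f ` {a, b}"] fe[OF ab] i[OF ab] unfolding EF by simp
  then show False using d fF' i unfolding good_def by blast
qed

lemma triconn_if_3_connected:
  assumes "simple_graph L" "k_connected 3 L \<or> graph_iso L (complete_graph 3)"
  shows "triconn L"
  using assms(2)
proof
  assume "k_connected 3 L"
  then show ?thesis using assms(1) unfolding k_connected_def triconn_def by simp
next
  assume "graph_iso L (complete_graph 3)"
  then obtain f where f: "bij_betw f (verts L) {..<3 :: nat}" "nsets {..<3} 2 = (`) f ` edges L"
    unfolding graph_iso_def complete_graph_def by auto
  have card: "card (verts L) = 3" using bij_betw_same_card[OF f(1)] by simp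
  have fin: "finite (verts L)" using assms(1) unfolding simple_graph_def by blast
  have complete: "{u, v} \<in> edges L" if uv: "u \<in> verts L" "v \<in> verts L" "u \<noteq> v" for u v
  proof -
    have "f u \<noteq> f v" "f u < 3" "f v < 3" using f(1) uv unfolding bij_betw_def inj_on_def by auto
    then have "{f u, f v} \<in> nsets {..<3} 2" unfolding nsets_2_eq by auto
    then obtain e where e: "e \<in> edges L" "f ` e = f ` {u, v}" unfolding f(2) by auto
    have "e = {u, v}"
      using inj_on_image_eq_iff[OF bij_betw_imp_inj_on[OF f(1)], of e "{u, v}"] e(2) uv
        simple_edge_subset[OF assms(1) e(1)] by simp
    then show ?thesis using e(1) by simp
  qed
  have "connected_graph (delete_verts L X)" if X: "X \<subseteq> verts L" "card X < 3" for X
  proof -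
    \<comment> \<open>Fewer than three deletions leave a nonempty complete graph of the
      triangle.\<close>
    have "verts L - X \<noteq> {}" using X card fin by (metis Diff_eq_empty_iff less_irrefl subset_antisym)
    moreover have "(u, v) \<in> {(x, y). {x, y} \<in> edges (delete_verts L X)}\<^sup>*"
      if "u \<in> verts L - X" "v \<in> verts L - X" for u v
    proof (cases "u = v")
      case False
      then have "{u, v} \<in> edges (delete_verts L X)"
        using that complete unfolding delete_verts_def by auto
      then show ?thesis by auto
    qed simp
    ultimately show ?thesis unfolding connected_graph_def by (simp add: delete_verts_def)
  qed
  then show ?thesis unfolding triconn_def using assms(1) card by simp
qed

lemma minimal_ramsey_graphs_neq:
  assumes "triconn L" "triconn L'" "2 \<le> q" "\<nexists>\<phi>. emb \<phi> L' L"
  shows "minimal_ramsey_graphs q L \<noteq> minimal_ramsey_graphs q L'"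
proof
  assume eq: "minimal_ramsey_graphs q L = minimal_ramsey_graphs q L'"
  have sim: "simple_graph L" "simple_graph L'" using assms(1,2) by (auto intro: triconn_simple)
  obtain G :: "nat graph" where "simple_graph G" "colourable q L G \<noteq> colourable q L' G"
    using ex_distinguishing_graph[OF assms] by blast
  then show False using colourable_transfer[OF sim eq] colourable_transfer[OF sim(2,1) eq[symmetric]] by blast
qed

theorem theorem1p4:
  fixes H :: "'a graph" and H' :: "'b graph" and q :: nat
  assumes "simple_graph H" and "simple_graph H'"
    and "\<not> graph_iso H H'"
    and "k_connected 3 H \<or> graph_iso H (complete_graph 3)"
    and "k_connected 3 H' \<or> graph_iso H' (complete_graph 3)"
    and "q \<ge> 2"
  shows "minimal_ramsey_graphs q H \<noteq> minimal_ramsey_graphs q H'"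
proof -
  have tri: "triconn H" "triconn H'" using assms triconn_if_3_connected by blast+
  have "(\<nexists>\<phi>. emb \<phi> H' H) \<or> (\<nexists>\<phi>. emb \<phi> H H')" using emb_antisym assms(1-3) by blast
  then show ?thesis
    using minimal_ramsey_graphs_neq[OF tri assms(6)] minimal_ramsey_graphs_neq[OF tri(2,1) assms(6)] by metis
qed

end
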